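(* Let $G$ be a finite simple graph with girth at least five. If $G$ is vertex decomposable, then $\mathrm{Shed}(G)$ is a dominating set of $G$.
   Context: The girth of a graph is the number of vertices of a smallest induced cycle; an acyclic graph has infinite girth. For a graph $G=(V,E)$ and $x\in V$, $G\setminus x$ is the graph obtained by deleting $x$ and its incident edges; $N(x)$ is the set of neighbours of $x$, $N[x]=N(x)\cup\{x\}$, and $G\setminus N[x]$ is obtained by deleting all vertices of $N[x]$ and their incident edges. A graph is well-covered if all its maximal independent sets have the same cardinality. A graph $G$ is vertex decomposable if $G$ is well-covered and either (i) $G$ has no edges (possibly no vertices), or (ii) there is a vertex $x$ such that both $G\setminus x$ and $G\setminus N[x]$ are vertex decomposable. For a vertex decomposable graph $G$, $\mathrm{Shed}(G)$ is the set of vertices $x$ such that $G\setminus x$ and $G\setminus N[x]$ are both vertex decomposable. A set $D\subseteq V$ is dominating if every vertex of $V\setminus D$ is adjacent to a vertex of $D$. *)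

theory Defs
  imports "Graph_Theory.Digraph_Component" "HOL-Library.Extended_Nat"
begin

text \<open>
  A finite simple graph is a digraph satisfying the locale predicate \<^const>\<open>graph\<close>: finite,
  loop-free, without parallel arcs and symmetric. An undirected edge is thus a pair of opposite arcs.
\<close>

definition nbhd :: "('a, 'b) pre_digraph \<Rightarrow> 'a \<Rightarrow> 'a set" where
  "nbhd G x = {y. x \<rightarrow>\<^bsub>G\<^esub> y}"

definition closed_nbhd :: "('a, 'b) pre_digraph \<Rightarrow> 'a \<Rightarrow> 'a set" where
  "closed_nbhd G x = nbhd G x \<union> {x}"

definition delete_verts :: "('a, 'b) pre_digraph \<Rightarrow> 'a set \<Rightarrow> ('a, 'b) pre_digraph" where
  "delete_verts G S = G \<restriction> (verts G - S)"

text \<open>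
  The bound \<open>3 \<le> length p\<close> excludes the closed walks \<open>u, v, u\<close> along an edge and its reverse,
  which \<^const>\<open>pre_digraph.cycle\<close> admits. The last conjunct says that the subgraph induced on
  the vertices of \<open>p\<close> has no edges besides those of \<open>p\<close>.
\<close>
definition induced_cycle :: "('a, 'b) pre_digraph \<Rightarrow> 'b awalk \<Rightarrow> bool" where
  "induced_cycle G p \<longleftrightarrow>
     pre_digraph.cycle G p \<and> 3 \<le> length p \<and>
     (\<forall>u \<in> tail G ` set p. \<forall>v \<in> tail G ` set p. u \<rightarrow>\<^bsub>G\<^esub> v \<longrightarrow>
        (\<exists>e \<in> set p. {tail G e, head G e} = {u, v}))"

text \<open>The infimum of the empty set in \<^typ>\<open>enat\<close> is \<open>\<infinity>\<close>, the girth of an acyclic graph.\<close>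
definition girth :: "('a, 'b) pre_digraph \<Rightarrow> enat" where
  "girth G = (INF p \<in> {p. induced_cycle G p}. enat (card (tail G ` set p)))"

definition independent_set :: "('a, 'b) pre_digraph \<Rightarrow> 'a set \<Rightarrow> bool" where
  "independent_set G S \<longleftrightarrow> S \<subseteq> verts G \<and> (\<forall>u \<in> S. \<forall>v \<in> S. \<not> u \<rightarrow>\<^bsub>G\<^esub> v)"

definition maximal_independent_set :: "('a, 'b) pre_digraph \<Rightarrow> 'a set \<Rightarrow> bool" where
  "maximal_independent_set G S \<longleftrightarrow>
     independent_set G S \<and> (\<forall>T. independent_set G T \<longrightarrow> S \<subseteq> T \<longrightarrow> S = T)"

definition well_covered :: "('a, 'b) pre_digraph \<Rightarrow> bool" where
  "well_covered G \<longleftrightarrow>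
     (\<forall>S T. maximal_independent_set G S \<longrightarrow> maximal_independent_set G T \<longrightarrow> card S = card T)"

inductive vertex_decomposable :: "('a, 'b) pre_digraph \<Rightarrow> bool" where
  no_edges: "well_covered G \<Longrightarrow> arcs G = {} \<Longrightarrow> vertex_decomposable G"
| shedding: "well_covered G \<Longrightarrow> x \<in> verts G \<Longrightarrow>
    vertex_decomposable (delete_verts G {x}) \<Longrightarrow>
    vertex_decomposable (delete_verts G (closed_nbhd G x)) \<Longrightarrow> vertex_decomposable G"

definition Shed :: "('a, 'b) pre_digraph \<Rightarrow> 'a set" where
  "Shed G = {x \<in> verts G. vertex_decomposable (delete_verts G {x}) \<and>
     vertex_decomposable (delete_verts G (closed_nbhd G x))}"

definition dominating_set :: "('a, 'b) pre_digraph \<Rightarrow> 'a set \<Rightarrow> bool" where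
  "dominating_set G D \<longleftrightarrow>
     D \<subseteq> verts G \<and> (\<forall>v \<in> verts G - D. \<exists>d \<in> D. v \<rightarrow>\<^bsub>G\<^esub> d)"

end

theory Submission
  imports Defs
begin

text \<open>
  Deletions and links are induced subgraphs, so one can work with vertex sets \<open>V\<close> of a fixed graph.
  In a vertex decomposable graph of girth at least five every vertex is isolated, or an end of a
  pendant edge, or lies on a 5-cycle \<open>a b c d e\<close> whose vertices \<open>b\<close>, \<open>d\<close>, \<open>e\<close> have degree two. Isolated
  vertices, neighbours of leaves, and the vertices \<open>a\<close> and \<open>c\<close> of such a 5-cycle are shedding, so every
  closed neighbourhood contains a shedding vertex.

  The structural claim goes by induction on the number of vertices. Let \<open>x\<close> be a non-isolated shedding
  vertex. Since \<open>V\<close> and \<open>V - x\<close> are well-covered, no independent set disjoint from \<open>N[x]\<close>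
  dominates \<open>N(x)\<close>. If \<open>x\<close> had no leaf neighbour and were on no such 5-cycle, the induction hypothesis for
  \<open>V - x\<close> and for the links \<open>V - N[v]\<close> would allow choosing one vertex other than \<open>x\<close> next to each
  neighbour of \<open>x\<close> so that the chosen vertices are independent. The remaining configurations
  are excluded by one exchange: if an independent set disjoint from \<open>N[x]\<close> dominates all neighbours
  other than \<open>x\<close> of two vertices \<open>y\<close>, \<open>y'\<close> of \<open>N(x)\<close>, then replacing \<open>x\<close> by \<open>y\<close>, \<open>y'\<close> enlarges
  a maximal independent set.
\<close>

section \<open>Vertex decomposable vertex sets\<close>

locale simple_adj =
  fixes adj :: "'a \<Rightarrow> 'a \<Rightarrow> bool"  (infix \<open>\<sim>\<close> 50)
  assumes adj_sym: "u \<sim> v \<Longrightarrow> v \<sim> u"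
    and adj_irrefl: "\<not> u \<sim> u"
begin

text \<open>The vertex \<open>v\<close> itself may lie outside \<open>V\<close>, as when an isolated
  vertex is added to a set.\<close>

definition nbrs :: "'a set \<Rightarrow> 'a \<Rightarrow> 'a set" where
  "nbrs V v = {u \<in> V. v \<sim> u}"

definition link :: "'a set \<Rightarrow> 'a \<Rightarrow> 'a set" where
  "link V v = V - insert v {u. v \<sim> u}"

definition indep :: "'a set \<Rightarrow> bool" where
  "indep S \<longleftrightarrow> (\<forall>u\<in>S. \<forall>v\<in>S. \<not> u \<sim> v)"

text \<open>Maximality is phrased as domination of \<open>V - S\<close>, the form that extensions
  and exchanges use.\<close>

definition max_indep :: "'a set \<Rightarrow> 'a set \<Rightarrow> bool" where
  "max_indep V S \<longleftrightarrow> S \<subseteq> V \<and> indep S \<and> (\<forall>v\<in>V - S. \<exists>s\<in>S. s \<sim> v)"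

definition well_cov :: "'a set \<Rightarrow> bool" where
  "well_cov V \<longleftrightarrow> (\<forall>S T. max_indep V S \<longrightarrow> max_indep V T \<longrightarrow> card S = card T)"

inductive vdec :: "'a set \<Rightarrow> bool" where
  edgeless: "well_cov V \<Longrightarrow> indep V \<Longrightarrow> vdec V"
| shed: "well_cov V \<Longrightarrow> x \<in> V \<Longrightarrow> vdec (V - {x}) \<Longrightarrow> vdec (link V x) \<Longrightarrow> vdec V"

lemma vdec_well_cov: "vdec V \<Longrightarrow> well_cov V"
  by (cases rule: vdec.cases) auto

lemma nbrs_memD: "u \<in> nbrs V v \<Longrightarrow> u \<in> V \<and> v \<sim> u \<and> u \<sim> v"
  using adj_sym by (simp add: nbrs_def)

lemma link_eq: "link V v = V - insert v (nbrs V v)"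
  by (auto simp: link_def nbrs_def)

lemma nbrs_memI: "u \<in> V \<Longrightarrow> v \<sim> u \<Longrightarrow> u \<in> nbrs V v"
  by (simp add: nbrs_def)

section \<open>Extension and exchange of independent sets\<close>

lemma indep_insert:
  "indep (insert v S) \<longleftrightarrow> indep S \<and> (\<forall>s\<in>S. \<not> s \<sim> v)"
  using adj_irrefl adj_sym by (auto simp: indep_def)

lemma well_cov_card_eq: "well_cov V \<Longrightarrow> max_indep V S \<Longrightarrow> max_indep V T \<Longrightarrow> card S = card T"
  unfolding well_cov_def by blast

lemma max_indepD:
  assumes "max_indep V M"
  shows "M \<subseteq> V" "indep M" "finite V \<Longrightarrow> finite M"
  using assms finite_subset[of M V] by (auto simp: max_indep_def)

lemma max_indep_extend:
  assumes "finite V" "S \<subseteq> V" "indep S"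
  shows "\<exists>M. S \<subseteq> M \<and> max_indep V M"
  using assms
proof (induction "card (V - S)" arbitrary: S rule: less_induct)
  case less
  show ?case
  proof (cases "max_indep V S")
    case False
    then obtain v where v: "v \<in> V - S" "\<forall>s\<in>S. \<not> s \<sim> v"
      using less.prems by (auto simp: max_indep_def)
    have "card (V - insert v S) < card (V - S)"
      using v less.prems by (intro psubset_card_mono) auto
    moreover have "indep (insert v S)" using v less.prems by (simp add: indep_insert)
    ultimately show ?thesis using less.hyps[of "insert v S"] v less.prems by auto
  qed auto
qed

lemma well_cov_indep_card_le:
  assumes "finite V" "well_cov V" "max_indep V M" "S \<subseteq> V" "indep S"
  shows "card S \<le> card M"
proof -
  obtain M' where M': "S \<subseteq> M'" "max_indep V M'" using max_indep_extend[OF assms(1,4,5)] by auto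
  have "finite M'" using max_indepD[OF M'(2)] assms(1) by simp
  then have "card S \<le> card M'" using M' card_mono by blast
  also have "\<dots> = card M" using well_cov_card_eq[OF assms(2) M'(2) assms(3)] by simp
  finally show ?thesis .
qed

text \<open>Extend \<open>insert x S\<close> to a maximal independent \<open>M\<close>. Apart from
  \<open>x\<close>, nothing in \<open>M\<close> is adjacent to \<open>y\<close> or
  \<open>y'\<close>, because \<open>S\<close> already dominates their other neighbours. Trading
  \<open>x\<close> for \<open>y\<close> and \<open>y'\<close> then beats
  \<open>card M\<close>.\<close>

lemma no_two_freed_nbrs:
  assumes "finite V" "well_cov V" "x \<in> V" "S \<subseteq> link V x" "indep S"
    and y: "y \<in> nbrs V x" "y' \<in> nbrs V x" "y \<noteq> y'"
    and dom: "\<And>z. z \<in> nbrs V y \<Longrightarrow> z \<noteq> x \<Longrightarrow> \<exists>s\<in>S. s \<sim> z"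
      "\<And>z. z \<in> nbrs V y' \<Longrightarrow> z \<noteq> x \<Longrightarrow> \<exists>s\<in>S. s \<sim> z"
  shows False
proof -
  have xS: "\<not> s \<sim> x" "s \<noteq> x" "s \<in> V" if "s \<in> S" for s
    using that assms(4) adj_sym by (auto simp: link_def)
  have "indep (insert x S)" using xS assms(5) by (simp add: indep_insert)
  then obtain M where M: "insert x S \<subseteq> M" "max_indep V M"
    using max_indep_extend[of V "insert x S"] assms(1,3) xS by auto
  have MV: "M \<subseteq> V" "finite M" and iM: "indep M"
    using max_indepD[OF M(2)] assms(1) by auto
  have ny: "\<not> m \<sim> y" "\<not> m \<sim> y'" if "m \<in> M" "m \<noteq> x" for m
  proof -
    have *: "\<not> s \<sim> m" if "s \<in> S" for s
      using that M \<open>m \<in> M\<close> iM by (auto simp: indep_def)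
    show "\<not> m \<sim> y" "\<not> m \<sim> y'"
      using * dom[of m] that MV adj_sym by (auto simp: nbrs_def)
  qed
  have yM: "y \<notin> M" "y' \<notin> M"
    using M y iM by (auto simp: indep_def nbrs_def)
  have "\<not> y \<sim> y'"
  proof
    assume "y \<sim> y'"
    then obtain s where "s \<in> S" "s \<sim> y'"
      using dom(1)[of y'] y adj_irrefl by (auto simp: nbrs_def)
    then show False using ny[of s] M xS by blast
  qed
  then have "indep (insert y (insert y' (M - {x})))"
    using iM ny adj_sym unfolding indep_insert by (auto simp: indep_def)
  moreover have "insert y (insert y' (M - {x})) \<subseteq> V"
    using MV y by (auto simp: nbrs_def)
  ultimately have "card (insert y (insert y' (M - {x}))) \<le> card M"
    using well_cov_indep_card_le[OF assms(1,2) M(2)] by blast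
  moreover have "x \<in> M" using M by simp
  ultimately show False
    using yM y(3) MV card_gt_0_iff[of M] by (auto simp: card_insert_if card_Diff_singleton)
qed

text \<open>If \<open>S\<close> dominated \<open>N(x)\<close>, a maximal independent set of
  \<open>V - {x}\<close> containing \<open>S\<close> would gain \<open>x\<close> in
  \<open>V\<close>. One through a neighbour of \<open>x\<close> is maximal in both sets, so the two
  common cardinalities would have to agree and to differ by one.\<close>

lemma no_dominating_indep:
  assumes "finite V" "well_cov V" "well_cov (V - {x})" "x \<in> V" "nbrs V x \<noteq> {}"
    "S \<subseteq> link V x" "indep S"
  shows "\<exists>y\<in>nbrs V x. \<forall>s\<in>S. \<not> s \<sim> y"
proof (rule ccontr)
  assume "\<not> ?thesis"
  then have dom: "\<exists>s\<in>S. s \<sim> y" if "y \<in> nbrs V x" for y using that by blast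
  obtain M where M: "S \<subseteq> M" "max_indep (V - {x}) M"
    using max_indep_extend[of "V - {x}" S] assms by (auto simp: link_def)
  have fM: "finite M" using max_indepD[OF M(2)] assms(1) by simp
  have nM: "\<not> m \<sim> x" if "m \<in> M" for m
  proof
    assume "m \<sim> x"
    then have "m \<in> nbrs V x" using that M adj_sym by (auto simp: max_indep_def nbrs_def)
    then obtain s where "s \<in> S" "s \<sim> m" using dom by blast
    then show False using M that by (auto simp: max_indep_def indep_def)
  qed
  have xM: "x \<notin> M" using M by (auto simp: max_indep_def)
  have "max_indep V (insert x M)"
    using M nM assms(4) by (auto simp: max_indep_def indep_insert)
  obtain y where y: "y \<in> V" "x \<sim> y" using assms(5) by (auto simp: nbrs_def)
  have "indep {y}" using adj_irrefl by (simp add: indep_def)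
  then obtain M2 where M2: "{y} \<subseteq> M2" "max_indep V M2"
    using max_indep_extend[of V "{y}"] y assms(1) by auto
  have "x \<notin> M2" using M2 y adj_sym by (auto simp: max_indep_def indep_def)
  then have "max_indep (V - {x}) M2" using M2 by (auto simp: max_indep_def)
  then have "card M2 = card M" using well_cov_card_eq[OF assms(3)] M(2) by blast
  moreover have "card M2 = card (insert x M)"
    using well_cov_card_eq[OF assms(2)] M2 \<open>max_indep V (insert x M)\<close> by blast
  ultimately show False using xM fM by simp
qed

section \<open>Links, isolated vertices and leaves\<close>

lemma well_cov_link:
  assumes "finite V" "well_cov V" "v \<in> V"
  shows "well_cov (link V v)"
proof -
  have *: "max_indep V (insert v M) \<and> card (insert v M) = Suc (card M)"
    if "max_indep (link V v) M" for M
  proof -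
    have "finite M" "v \<notin> M"
      using max_indepD[OF that] assms(1) by (auto simp: link_def)
    moreover have "max_indep V (insert v M)"
      using that assms(3) adj_sym by (auto simp: max_indep_def link_def indep_insert)
    ultimately show ?thesis by simp
  qed
  show ?thesis
    unfolding well_cov_def
  proof (intro allI impI)
    fix S T assume "max_indep (link V v) S" "max_indep (link V v) T"
    from this[THEN *] show "card S = card T"
      using well_cov_card_eq[OF assms(2)] by (metis nat.inject)
  qed
qed

lemma indep_subset: "indep S \<Longrightarrow> T \<subseteq> S \<Longrightarrow> indep T"
  by (auto simp: indep_def)

text \<open>If \<open>v\<close> and \<open>x\<close> are distinct and nonadjacent, deletions and
  links commute, so \<open>x\<close> still sheds \<open>link V v\<close>; if they are adjacent, the
  link of \<open>v\<close> is already a link in \<open>V - {x}\<close>.\<close>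

lemma vdec_link:
  assumes "vdec V" "finite V" "v \<in> V"
  shows "vdec (link V v)"
  using assms
proof (induction arbitrary: v rule: vdec.induct)
  case (edgeless V)
  then show ?case
    by (intro vdec.edgeless well_cov_link) (auto simp: link_def elim: indep_subset)
next
  case (shed V x)
  consider "v = x" | "v \<noteq> x" "v \<sim> x" | "v \<noteq> x" "\<not> v \<sim> x" by blast
  then show ?case
  proof cases
    case 1 with shed show ?thesis by simp
  next
    case 2
    then have "link V v = link (V - {x}) v" by (auto simp: link_def)
    then show ?thesis using shed 2 by simp
  next
    case 3
    have "link V v - {x} = link (V - {x}) v" "link (link V v) x = link (link V x) v"
      by (auto simp: link_def)
    moreover have "vdec (link (V - {x}) v)" using shed 3 by simp
    moreover have "vdec (link (link V x) v)"
      using shed 3 adj_sym by (auto simp: link_def)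
    moreover have "x \<in> link V v" using shed 3 by (auto simp: link_def)
    ultimately show ?thesis
      using vdec.shed[of "link V v" x] well_cov_link[of V v] shed.prems shed.hyps by simp
  qed
qed

lemma well_cov_insert_isolated:
  assumes "well_cov H" "finite H" "nbrs H z = {}" "z \<notin> H"
  shows "well_cov (insert z H)"
proof -
  have *: "max_indep H (M - {z}) \<and> card M = Suc (card (M - {z}))"
    if M: "max_indep (insert z H) M" for M
  proof -
    have "z \<in> M" using M assms(3) adj_sym by (fastforce simp: max_indep_def nbrs_def)
    moreover have "finite M"
      using max_indepD[OF M] assms(2) by simp
    moreover have "max_indep H (M - {z})"
      using M assms(3,4) unfolding max_indep_def nbrs_def
      by (auto elim: indep_subset)
    ultimately show ?thesis by (metis card.remove)
  qed
  show ?thesis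
    unfolding well_cov_def
  proof (intro allI impI)
    fix S T assume "max_indep (insert z H) S" "max_indep (insert z H) T"
    from this[THEN *] show "card S = card T"
      using well_cov_card_eq[OF assms(1)] by metis
  qed
qed

text \<open>The shedding order of \<open>H\<close> is kept: deletions and links merely carry the
  isolated \<open>z\<close> along.\<close>

lemma vdec_insert_isolated:
  assumes "vdec H" "finite H" "nbrs H z = {}"
  shows "vdec (insert z H)"
proof (cases "z \<in> H")
  case True with assms show ?thesis by (simp add: insert_absorb)
next
  case False
  with assms show ?thesis
  proof (induction rule: vdec.induct)
    case (edgeless V)
    then have "indep (insert z V)" using adj_sym by (auto simp: indep_insert nbrs_def)
    then show ?case using edgeless well_cov_insert_isolated by (intro vdec.edgeless) auto
  next
    case (shed V x)
    have "insert z V - {x} = insert z (V - {x})" using shed by auto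
    moreover have "link (insert z V) x = insert z (link V x)"
      using shed adj_sym by (auto simp: link_def nbrs_def)
    moreover have "nbrs (V - {x}) z = {}" "nbrs (link V x) z = {}"
      using shed by (auto simp: nbrs_def link_def)
    moreover have "finite (link V x)" "z \<notin> link V x"
      using shed by (auto simp: link_def)
    ultimately show ?case
      using shed well_cov_insert_isolated by (intro vdec.shed[of "insert z V" x]) auto
  qed
qed

text \<open>\<open>V - {x}\<close> is the link of the leaf \<open>y\<close> with \<open>y\<close>
  put back as an isolated vertex.\<close>

lemma vdec_delete_support:
  assumes "vdec V" "finite V" "y \<in> V" "nbrs V y = {x}"
  shows "vdec (V - {x})"
proof -
  have "x \<noteq> y" using assms(4) adj_irrefl by (auto simp: nbrs_def)
  then have "V - {x} = insert y (link V y)"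
    using assms(3,4) by (auto simp: link_def nbrs_def)
  moreover have "nbrs (link V y) y = {}" by (auto simp: link_def nbrs_def)
  moreover have "finite (link V y)" using assms(2) by (auto simp: link_def)
  ultimately show ?thesis using vdec_insert_isolated vdec_link assms by metis
qed

lemma vdec_delete_isolated:
  assumes "vdec V" "finite V" "v \<in> V" "nbrs V v = {}"
  shows "vdec (V - {v})"
proof -
  have "V - {v} = link V v" using assms by (auto simp: link_def nbrs_def)
  then show ?thesis using vdec_link assms by simp
qed

text \<open>Under the second assumption, maximal independent sets of \<open>V - {a}\<close> stay
  maximal in \<open>V\<close>.\<close>

lemma well_cov_delete:
  assumes "well_cov V" "\<And>M. max_indep (V - {a}) M \<Longrightarrow> \<exists>m\<in>M. m \<sim> a"
  shows "well_cov (V - {a})"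
proof -
  have "max_indep V M" if "max_indep (V - {a}) M" for M
    using that assms(2)[OF that] by (auto simp: max_indep_def)
  then show ?thesis using well_cov_card_eq[OF assms(1)] unfolding well_cov_def by blast
qed

end

section \<open>Pendant edges and basic pentagons\<close>

locale girth5_adj = simple_adj +
  assumes no_triangle: "a \<sim> b \<Longrightarrow> b \<sim> c \<Longrightarrow> \<not> c \<sim> a"
    and no_square: "a \<sim> b \<Longrightarrow> b \<sim> c \<Longrightarrow> c \<sim> d \<Longrightarrow> d \<sim> a \<Longrightarrow> a = c \<or> b = d"
begin

text \<open>
  A 5-cycle is basic if no two of its adjacent vertices have degree at least three. It can then be
  labelled \<open>a b c d e\<close> such that only \<open>a\<close> and \<open>c\<close> may have degree at least three.
\<close>
definition basic_pentagon :: "'a set \<Rightarrow> 'a \<Rightarrow> 'a \<Rightarrow> 'a \<Rightarrow> 'a \<Rightarrow> 'a \<Rightarrow> bool" where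
  "basic_pentagon V a b c d e \<longleftrightarrow> b \<in> V \<and> c \<sim> d \<and> nbrs V b = {a, c} \<and> nbrs V d = {c, e} \<and> nbrs V e = {d, a}"

text \<open>The second alternative covers both ends of a pendant edge: \<open>v\<close> is the leaf
  \<open>l\<close>, or a vertex of \<open>V\<close> adjacent to \<open>l\<close> and hence
  \<open>u\<close>.\<close>

definition good :: "'a set \<Rightarrow> 'a \<Rightarrow> bool" where
  "good V v \<longleftrightarrow> nbrs V v = {} \<or> (\<exists>l\<in>V. \<exists>u. (l = v \<or> l \<sim> v) \<and> nbrs V l = {u}) \<or>
     (\<exists>a b c d e. basic_pentagon V a b c d e \<and> v \<in> {a, b, c, d, e})"

text \<open>The reflection fixing \<open>b\<close>; it swaps the two vertices that may have large
  degree.\<close>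

lemma basic_pentagon_sym: "basic_pentagon V a b c d e \<Longrightarrow> basic_pentagon V c b a e d"
  using adj_sym[of e a] nbrs_memD[of a V e] by (simp add: basic_pentagon_def insert_commute)

lemma basic_pentagonD:
  assumes "basic_pentagon V a b c d e"
  shows "a \<in> V" "b \<in> V" "c \<in> V" "d \<in> V" "e \<in> V"
    and "a \<sim> b" "b \<sim> c" "c \<sim> d" "d \<sim> e" "e \<sim> a"
    and "distinct [a, b, c, d, e]"
    and "nbrs V b = {a, c}" "nbrs V d = {c, e}" "nbrs V e = {d, a}"
proof -
  show nbs: "nbrs V b = {a, c}" "nbrs V d = {c, e}" "nbrs V e = {d, a}"
    using assms by (simp_all add: basic_pentagon_def)
  have "a \<in> nbrs V b" "c \<in> nbrs V b" "e \<in> nbrs V d" "d \<in> nbrs V e" "a \<in> nbrs V e" "b \<in> V" "c \<sim> d"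
    using assms nbs by (simp_all add: basic_pentagon_def)
  note * = this(1-5)[THEN nbrs_memD] this(6,7)
  show "a \<in> V" "b \<in> V" "c \<in> V" "d \<in> V" "e \<in> V"
    using * by simp_all
  show adj: "a \<sim> b" "b \<sim> c" "c \<sim> d" "d \<sim> e" "e \<sim> a"
    using * by simp_all
  \<comment> \<open>Identifying two non-consecutive vertices would close a triangle.\<close>
  show "distinct [a, b, c, d, e]"
    using adj adj_irrefl no_triangle[of c d e] no_triangle[of d e a] no_triangle[of e a b]
      no_triangle[of a b c] no_triangle[of b c d] by auto
qed

lemma no_commons: "x \<sim> y \<Longrightarrow> x \<sim> y' \<Longrightarrow> w \<sim> y \<Longrightarrow> w \<sim> y' \<Longrightarrow> x \<noteq> w \<Longrightarrow> y = y'"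
  using no_square[of x y w y'] adj_sym by blast

text \<open>\<open>d\<close> sheds \<open>V - {a}\<close>: deleting it isolates \<open>e\<close>,
  and taking its link isolates \<open>b\<close>. Without these isolated vertices, what remains is
  \<open>link V e\<close> or \<open>link (link V e) b\<close>.\<close>

lemma vdec_delete_basic_pentagon:
  assumes "finite V" "vdec V" "basic_pentagon V a b c d e"
  shows "vdec (V - {a})"
proof -
  note C = basic_pentagonD[OF assms(3)]
  have link_e: "link V e = V - {e, d, a}" and link_d: "link V d = V - {d, c, e}"
    and link_b: "link V b = V - {b, a, c}"
    by (simp_all only: link_eq C(12-14) insert_commute)
  have "well_cov (V - {a})"
  \<comment> \<open>If \<open>M\<close> misses all neighbours of \<open>a\<close>, then only
    \<open>c\<close> can dominate \<open>b\<close> and only \<open>d\<close> can dominate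
    \<open>e\<close>, but \<open>c \<sim> d\<close>.\<close>
  proof (rule well_cov_delete[OF vdec_well_cov[OF assms(2)]], rule ccontr)
    fix M assume M: "max_indep (V - {a}) M" and na: "\<not> (\<exists>m\<in>M. m \<sim> a)"
    have "b \<notin> M" "e \<notin> M" using na C adj_sym by blast+
    then have "b \<in> V - {a} - M" "e \<in> V - {a} - M" using C(2,5,11) by auto
    then obtain s t where st: "s \<in> M" "s \<sim> b" "t \<in> M" "t \<sim> e"
      using M unfolding max_indep_def by blast
    then have "s \<in> nbrs V b" "t \<in> nbrs V e" "s \<noteq> a" "t \<noteq> a"
      using M adj_sym by (auto simp: max_indep_def nbrs_def)
    then have "s = c" "t = d" using C by auto
    then show False using st C M by (auto simp: max_indep_def indep_def)
  qed
  moreover have "vdec (V - {a} - {d})"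
  proof -
    have "V - {a} - {d} = insert e (link V e)" using link_e C by auto
    moreover have "nbrs (link V e) e = {}" by (auto simp: nbrs_def link_def)
    moreover have "vdec (link V e)" using vdec_link assms C by blast
    moreover have "finite (link V e)" using assms(1) by (simp add: link_e)
    ultimately show ?thesis using vdec_insert_isolated by metis
  qed
  moreover have "vdec (link (V - {a}) d)"
  proof -
    let ?W = "link (link V e) b"
    have "b \<in> link V e" using link_e C by auto
    then have "vdec ?W" using vdec_link[of "link V e" b] vdec_link[of V e] assms C link_e by simp
    moreover have "?W = link V b - {e, d, a}" using link_e by (auto simp: link_def)
    then have "link (V - {a}) d = insert b ?W"
      using link_b link_d C(2,11) by (auto simp: link_def)
    moreover have "nbrs ?W b = {}" by (auto simp: nbrs_def link_def)
    moreover have "finite ?W" using assms(1) by (auto simp: link_def)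
    ultimately show ?thesis using vdec_insert_isolated by metis
  qed
  moreover have "d \<in> V - {a}" using C by auto
  ultimately show ?thesis using vdec.shed[of "V - {a}" d] by blast
qed

text \<open>Only the deletion is asserted, since \<open>vdec_link\<close> supplies the link of
  \<open>d\<close>.\<close>

lemma good_imp_shed_nearby:
  assumes "finite V" "vdec V" "v \<in> V" "good V v"
  shows "\<exists>d\<in>V. vdec (V - {d}) \<and> (d = v \<or> v \<sim> d)"
proof -
  consider "nbrs V v = {}" | l u where "l \<in> V" "l = v \<or> l \<sim> v" "nbrs V l = {u}"
    | a b c d e where "basic_pentagon V a b c d e" "v \<in> {a, b, c, d, e}"
    using assms(4) unfolding good_def by blast
  then show ?thesis
  proof cases
    case 1
    then show ?thesis using vdec_delete_isolated assms by blast
  next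
    case 2
    have "u \<in> V" "l \<sim> u" using 2(3) by (auto simp: nbrs_def)
    moreover have "l \<sim> v \<Longrightarrow> v = u" using 2(3) assms(3) by (auto simp: nbrs_def)
    moreover have "vdec (V - {u})" using vdec_delete_support assms 2 by blast
    ultimately show ?thesis using 2(2) by blast
  next
    case 3
    note C = basic_pentagonD[OF 3(1)]
    have "vdec (V - {a})" "vdec (V - {c})"
      using vdec_delete_basic_pentagon assms(1,2) 3(1) basic_pentagon_sym by blast+
    then show ?thesis using 3(2) C(1-10) adj_sym by auto
  qed
qed

end

section \<open>The structure at a shedding vertex\<close>

text \<open>The induction step at a non-isolated \<open>x\<close>. \<open>no_dom\<close> is what
  \<open>no_dominating_indep\<close> yields, and at the empty set it returns a neighbour of
  \<open>x\<close>; \<open>good_del\<close> and \<open>good_link\<close> are induction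
  hypotheses.\<close>

locale shed_vertex = girth5_adj +
  fixes V x
  assumes fin: "finite V" and wcV: "well_cov V" and xV: "x \<in> V"
    and no_dom: "S \<subseteq> link V x \<Longrightarrow> indep S \<Longrightarrow> \<exists>y\<in>nbrs V x. \<forall>s\<in>S. \<not> s \<sim> y"
    and good_del: "v \<in> V - {x} \<Longrightarrow> good (V - {x}) v"
    and good_link: "v \<in> V \<Longrightarrow> x \<in> link V v \<Longrightarrow> good (link V v) x"
begin

abbreviation N where "N \<equiv> nbrs V x"

definition Y :: "'a \<Rightarrow> 'a set" where
  "Y y = nbrs V y - {x}"

lemma N_D: "y \<in> N \<Longrightarrow> y \<in> V \<and> x \<sim> y \<and> y \<sim> x \<and> y \<noteq> x"
  using adj_sym adj_irrefl by (auto simp: nbrs_def)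

lemma Y_D:
  assumes "y \<in> N" "w \<in> Y y"
  shows "w \<in> V" "w \<noteq> x" "y \<sim> w" "w \<sim> y" "\<not> w \<sim> x" "\<not> x \<sim> w" "w \<notin> N" "w \<in> link V x"
proof -
  show *: "w \<in> V" "w \<noteq> x" "y \<sim> w" "w \<sim> y"
    using assms adj_sym by (auto simp: Y_def nbrs_def)
  show "\<not> w \<sim> x" "\<not> x \<sim> w" using * N_D[OF assms(1)] no_triangle adj_sym by metis+
  then show "w \<notin> N" "w \<in> link V x" using * by (auto simp: nbrs_def link_def)
qed

lemma Y_I: "y \<in> N \<Longrightarrow> w \<in> V \<Longrightarrow> y \<sim> w \<Longrightarrow> w \<noteq> x \<Longrightarrow> w \<in> Y y"
  by (auto simp: Y_def nbrs_def)

text \<open>The sets \<open>Y y\<close> are thus pairwise disjoint: a common element would close a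
  4-cycle through \<open>x\<close>.\<close>

lemma Y_inj: "y \<in> N \<Longrightarrow> y' \<in> N \<Longrightarrow> w \<sim> y \<Longrightarrow> w \<sim> y' \<Longrightarrow> w \<noteq> x \<Longrightarrow> y = y'"
  using no_commons[of x y y' w] N_D by blast

lemma exchange:
  assumes "S \<subseteq> link V x" "indep S" "y \<in> N" "y' \<in> N" "y \<noteq> y'"
    and "\<And>z. z \<in> Y y \<Longrightarrow> \<exists>s\<in>S. s \<sim> z" "\<And>z. z \<in> Y y' \<Longrightarrow> \<exists>s\<in>S. s \<sim> z"
  shows False
  using no_two_freed_nbrs[OF fin wcV xV assms(1-5)] assms(6,7) by (auto simp: Y_def)

lemma nbrs_delete: "\<not> v \<sim> x \<Longrightarrow> nbrs (V - {x}) v = nbrs V v"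
  by (auto simp: nbrs_def)

end

text \<open>The situation to be refuted: \<open>x\<close> has no leaf neighbour and lies on no pentagon
  \<open>x y w w' y'\<close> in which \<open>y\<close> and \<open>y'\<close> have degree two.\<close>
locale spare_free_vertex = shed_vertex +
  assumes Y_nonempty: "y \<in> N \<Longrightarrow> Y y \<noteq> {}"
    and Y_singletons: "y \<in> N \<Longrightarrow> y' \<in> N \<Longrightarrow> Y y = {w} \<Longrightarrow> Y y' = {w'} \<Longrightarrow> \<not> w \<sim> w'"
begin

text \<open>A transversal of the sets \<open>Y y\<close> would dominate \<open>N\<close>, against
  \<open>no_dom\<close>.\<close>

lemma no_transversal:
  assumes "T \<subseteq> link V x" "indep T"
  shows "\<exists>y\<in>N. Y y \<inter> T = {}"
proof -
  obtain y where "y \<in> N" "\<forall>s\<in>T. \<not> s \<sim> y" using no_dom assms by blast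
  then show ?thesis using Y_D(4) by blast
qed

text \<open>With \<open>N = {a, b}\<close>, a nonadjacent choice from \<open>Y a\<close> and
  \<open>Y b\<close> would be a transversal. So all such pairs are adjacent, absence of 4-cycles
  makes both sets singletons, and \<open>Y_singletons\<close> is violated.\<close>

lemma degree_ge_3: "\<not> N \<subseteq> {y, y'}"
proof
  assume sub: "N \<subseteq> {y, y'}"
  have "N \<noteq> {}" using no_dom[of "{}"] by (auto simp: indep_def)
  then obtain a b where N: "N = {a, b}" using sub by (metis insert_absorb2 subset_insert_iff subset_singletonD insert_Diff)
  have aN: "a \<in> N" and bN: "b \<in> N" using N by auto
  have adj: "w \<sim> w'" "w \<noteq> w'" if "w \<in> Y a" "w' \<in> Y b" for w w'
  proof -
    show "w \<sim> w'"
    proof (rule ccontr)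
      assume "\<not> w \<sim> w'"
      then have "indep {w, w'}" using adj_irrefl adj_sym by (auto simp: indep_def)
      moreover have "{w, w'} \<subseteq> link V x" using Y_D(8) that aN bN by blast
      ultimately obtain y where "y \<in> N" "Y y \<inter> {w, w'} = {}" using no_transversal by meson
      then show False using N that by auto
    qed
    then show "w \<noteq> w'" using adj_irrefl by auto
  qed
  obtain w w' where w: "w \<in> Y a" "w' \<in> Y b" using Y_nonempty aN bN by blast
  have "Y a = {w}"
  proof -
    have "v = w" if "v \<in> Y a" for v
      using no_commons[of a v w w'] adj(1)[OF that w(2)] adj(1)[OF w] Y_D(3)[OF aN that]
        Y_D(3)[OF aN w(1)] Y_D(7)[OF bN w(2)] aN adj_sym by blast
    then show ?thesis using w by blast
  qed
  moreover have "Y b = {w'}"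
  proof -
    have "v = w'" if "v \<in> Y b" for v
      using no_commons[of b v w' w] adj(1)[OF w(1) that] adj(1)[OF w] Y_D(3)[OF bN that]
        Y_D(3)[OF bN w(2)] Y_D(7)[OF aN w(1)] bN by blast
    then show ?thesis using w by blast
  qed
  ultimately show False using Y_singletons[OF aN bN] adj[OF w] by blast
qed

text \<open>As \<open>v\<close> has distance at least three from \<open>x\<close>, all of
  \<open>N\<close> survives in \<open>link V v\<close>, where \<open>x\<close> is good. Read back in
  \<open>V\<close>, a leaf next to \<open>x\<close> is a neighbour all of whose other neighbours see
  \<open>v\<close>, so there is only one of them; otherwise a basic pentagon of the link passes
  through \<open>x\<close>.\<close>

lemma link_cases:
  assumes "v \<in> V" "v \<noteq> x" "\<not> v \<sim> x" "\<And>y. y \<in> N \<Longrightarrow> \<not> v \<sim> y"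
  obtains (single) y w where "y \<in> N" "Y y = {w}" "v \<sim> w"
  | (pentagon) y1 w1 y2 w2 where "y1 \<in> N" "y2 \<in> N" "y1 \<noteq> y2" "w1 \<in> Y y1" "w2 \<in> Y y2" "w1 \<sim> w2"
      "\<not> v \<sim> w1" "\<not> v \<sim> w2" "w1 \<noteq> v" "w2 \<noteq> v"
      "\<And>z. z \<in> Y y1 \<Longrightarrow> z = w1 \<or> v \<sim> z" "\<And>z. z \<in> Y y2 \<Longrightarrow> z = w2 \<or> v \<sim> z"
proof -
  let ?H = "link V v"
  have xH: "x \<in> ?H" using assms xV by (auto simp: link_def)
  have NH: "nbrs ?H x = N" using assms(3,4) adj_sym by (auto simp: nbrs_def link_def)
  have nN: "v \<notin> N" using assms(3) adj_sym by (auto simp: nbrs_def)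
  have nbH: "z \<in> nbrs ?H y \<longleftrightarrow> z = x \<or> (z \<in> Y y \<and> \<not> v \<sim> z)" if "y \<in> N" for y z
    using that assms xH N_D[OF that] adj_sym by (auto simp: nbrs_def link_def Y_def)
  have five: thesis if "basic_pentagon ?H x b c d e" for b c d e
  proof -
    note C = basic_pentagonD[OF that]
    have be: "b \<in> N" "e \<in> N" using C NH adj_sym by (auto simp: nbrs_def)
    have Hv: "\<not> v \<sim> c" "\<not> v \<sim> d" "c \<noteq> v" "d \<noteq> v"
      using C(3,4) by (auto simp: link_def)
    have "c \<in> Y b" using nbH[OF be(1), of c] C by auto
    moreover have "d \<in> Y e" using nbH[OF be(2), of d] C by auto
    moreover have "z = c \<or> v \<sim> z" if "z \<in> Y b" for z
      using nbH[OF be(1), of z] C that Y_D[OF be(1) that] by auto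
    moreover have "z = d \<or> v \<sim> z" if "z \<in> Y e" for z
      using nbH[OF be(2), of z] C that Y_D[OF be(2) that] by auto
    ultimately show thesis using pentagon[of b e c d] be C(8,11) Hv by auto
  qed
  consider "N = {}" | l u where "l \<in> ?H" "l = x \<or> l \<sim> x" "nbrs ?H l = {u}"
    | a b c d e where "basic_pentagon ?H a b c d e" "x \<in> {a, b, c, d, e}"
    using good_link[OF assms(1) xH] NH unfolding good_def by auto
  then show thesis
  proof cases
    case 1
    then show thesis using degree_ge_3 by auto
  next
    case 2
    show thesis
    proof (cases "l = x")
      case True
      then show thesis using 2 NH degree_ge_3[of u u] by auto
    next
      case False
      then have l: "l \<in> N" using 2 adj_sym by (auto simp: nbrs_def link_def)
      have Yv: "v \<sim> z" if "z \<in> Y l" for z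
        using nbH[OF l, of z] nbH[OF l, of x] 2(3) that Y_D[OF l that] by auto
      obtain w where w: "w \<in> Y l" using Y_nonempty l by blast
      have "z = w" if "z \<in> Y l" for z
        using no_commons[of v z w l] Yv[OF that] Yv[OF w] Y_D[OF l that] Y_D[OF l w] l nN by blast
      then have "Y l = {w}" using w by blast
      then show thesis using single l Yv w by blast
    qed
  next
    case 3
    note C = basic_pentagonD[OF 3(1)]
    \<comment> \<open>Degree at least three rules out the degree-two positions; position
      \<open>c\<close> reduces to \<open>a\<close> by reflection.\<close>
    have "x \<noteq> b" "x \<noteq> d" "x \<noteq> e" 
      using C(12-14) NH degree_ge_3[of a c] degree_ge_3[of c e] degree_ge_3[of d a] by auto
    then show thesis using five 3 basic_pentagon_sym[OF 3(1)] by blast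
  qed
qed

text \<open>The neighbours \<open>p\<close>, \<open>s\<close> of \<open>y\<close> lie on the pentagon \<open>y p q r s\<close>, basic in \<open>V - x\<close>, but \<open>p\<close> has a
  neighbour \<open>u\<close> off the pentagon, which may prevent choosing \<open>p\<close> in a transversal.\<close>
definition danger :: "'a \<Rightarrow> 'a \<Rightarrow> 'a \<Rightarrow> 'a \<Rightarrow> 'a \<Rightarrow> 'a \<Rightarrow> bool" where
  "danger y p s q r u \<longleftrightarrow> Y y = {p, s} \<and> q \<in> V \<and> nbrs V q = {p, r} \<and> r \<sim> s \<and>
     u \<in> nbrs V p \<and> u \<noteq> y \<and> u \<noteq> q \<and> (nbrs V r = {q, s} \<or> nbrs V s = {r, y})"

text \<open>On the pentagon \<open>y p q r s\<close>, an independent set avoiding \<open>y\<close>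
  contains at most one of \<open>q\<close> and \<open>r\<close>, so it leaves \<open>p\<close> or
  \<open>s\<close> available.\<close>

definition harmless :: "'a \<Rightarrow> bool" where
  "harmless y \<longleftrightarrow> (\<exists>p s q r. p \<in> Y y \<and> s \<in> Y y \<and> p \<noteq> s \<and>
     nbrs V p = {y, q} \<and> nbrs V s = {y, r} \<and> q \<sim> r)"

lemma harmlessI:
  "p \<in> Y y \<Longrightarrow> s \<in> Y y \<Longrightarrow> p \<noteq> s \<Longrightarrow> nbrs V p = {y, q} \<Longrightarrow> nbrs V s = {y, r} \<Longrightarrow> q \<sim> r \<Longrightarrow>
    harmless y"
  unfolding harmless_def by blast

lemma dangerD:
  assumes "y \<in> N" "danger y p s q r u"
  shows "p \<in> Y y" "s \<in> Y y" "q \<in> V" "r \<in> V" "u \<in> V"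
    and "p \<sim> q" "q \<sim> r" "r \<sim> s" "u \<sim> p"
    and "distinct [x, y, p, q, r, s, u]"
    and "\<not> q \<sim> x" "\<not> r \<sim> x" "\<not> u \<sim> x" "\<not> u \<sim> r" "\<not> u \<sim> y" "\<not> r \<sim> y" "\<not> p \<sim> s"
proof -
  show Y: "p \<in> Y y" "s \<in> Y y" and qV: "q \<in> V" using assms(2) by (auto simp: danger_def)
  have "p \<in> nbrs V q" "r \<in> nbrs V q" "u \<in> nbrs V p" and rs: "r \<sim> s" and u: "u \<noteq> y" "u \<noteq> q"
    using assms(2) by (auto simp: danger_def)
  note * = this(1-3)[THEN nbrs_memD]
  show adj: "r \<in> V" "u \<in> V" "p \<sim> q" "q \<sim> r" "r \<sim> s" "u \<sim> p"
    using * rs by auto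
  note y = N_D[OF assms(1)] and p = Y_D[OF assms(1) Y(1)] and s = Y_D[OF assms(1) Y(2)]
  show ps: "\<not> p \<sim> s" using no_triangle[of y p s] p s by blast
  have d1: "q \<noteq> x" "r \<noteq> x" "u \<noteq> x" using adj p s by blast+
  have d2: "q \<noteq> y" using no_triangle[of y r s] adj(4,5) s(4) by blast
  have d3: "p \<noteq> r" using adj(5) ps by blast
  have d4: "p \<noteq> s" using no_triangle[of p q r] adj by blast
  have d5: "r \<noteq> y" using no_triangle[of y p q] adj p by blast
  have d6: "q \<noteq> s" using adj ps by blast
  show ry: "\<not> r \<sim> y" using no_triangle[of r s y] adj s adj_sym[of r y] by blast
  show uy: "\<not> u \<sim> y" using no_triangle[of u p y] adj p adj_sym[of u y] by blast
  show ur: "\<not> u \<sim> r"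
    using no_commons[of p u q r] * adj_sym[of u r] adj d3 u by blast
  have d7: "u \<noteq> r" using no_triangle[of p q r] adj by blast
  have d8: "u \<noteq> s" using ps adj adj_sym by blast
  have d9: "u \<noteq> p" "q \<noteq> r" "r \<noteq> s" "p \<noteq> q" using adj adj_irrefl by blast+
  show "distinct [x, y, p, q, r, s, u]"
    using d1 d2 d3 d4 d5 d6 d7 d8 d9 y p s u by auto
  show "\<not> q \<sim> x"
  proof
    assume "q \<sim> x"
    then show False 
      using Y_inj[of y q p] assms(1) qV p adj d2 adj_sym[of q x] nbrs_memI[of q V x] by blast
  qed
  show "\<not> u \<sim> x"
  proof
    assume "u \<sim> x"
    then show False 
      using Y_inj[of y u p] assms(1) p * u adj_sym[of u x] nbrs_memI[of u V x] by blast
  qed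
  show "\<not> r \<sim> x"
  proof
    assume "r \<sim> x"
    then show False 
      using Y_inj[of y r s] assms(1) s adj d5 adj_sym[of r x] adj_sym[of r s] nbrs_memI[of r V x] by blast
  qed
qed

text \<open>The exchange is made at \<open>r\<close> instead of \<open>x\<close>: \<open>y\<close>
  dominates \<open>x\<close>, the other neighbour of \<open>y'\<close>, and \<open>u\<close>
  dominates \<open>p\<close>, the other neighbour of \<open>q\<close>.\<close>

lemma danger_not_single:
  assumes "y \<in> N" "danger y p s q r u" "y' \<in> N"
  shows "Y y' \<noteq> {r}"
proof
  assume Y': "Y y' = {r}"
  note D = dangerD[OF assms(1,2)]
  note p = Y_D[OF assms(1) D(1)] and y' = N_D[OF assms(3)] and y = N_D[OF assms(1)]
  have r: "r \<in> Y y'" using Y' by simp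
  note r = Y_D[OF assms(3) r]
  show False
  proof (rule no_two_freed_nbrs[OF fin wcV D(4), of "{u, y}" y' q])
    show "{u, y} \<subseteq> link V r"
      using D(5,10,14,16) y adj_sym by (auto simp: link_def)
    show "indep {u, y}"
      using D(15) adj_irrefl adj_sym by (auto simp: indep_def)
    show "y' \<in> nbrs V r" "q \<in> nbrs V r"
      using D(3,7) r y' adj_sym by (auto simp: nbrs_def)
    show "y' \<noteq> q" using y' D(11) by blast
    show "\<exists>s\<in>{u, y}. s \<sim> z" if "z \<in> nbrs V y'" "z \<noteq> r" for z
      using that Y' y by (auto simp: Y_def)
    show "\<exists>s\<in>{u, y}. s \<sim> z" if "z \<in> nbrs V q" "z \<noteq> r" for z
      using that assms(2) D(9) by (auto simp: danger_def)
  qed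
qed

text \<open>\<open>link_cases\<close> is applied to \<open>q\<close>, which sees only
  \<open>p\<close> and \<open>r\<close>. Its single case fails, since \<open>p\<close> lies in
  \<open>Y y\<close> alone and \<open>danger_not_single\<close> excludes \<open>r\<close>. A
  pentagon through \<open>y\<close> gives \<open>deg2\<close>; for any other,
  \<open>Y_singletons\<close> forces \<open>r\<close> into \<open>Y y1\<close> or
  \<open>Y y2\<close>, giving \<open>deg3\<close>.\<close>

lemma danger_cases:
  assumes "y \<in> N" "danger y p s q r u"
  obtains (deg2) y2 w where "y2 \<in> N" "Y y2 = {w}" "s \<sim> w" "nbrs V r = {q, s}" "w \<noteq> r" "w \<noteq> y"
  | (deg3) y1 w1 y2 w2 where "y1 \<in> N" "y2 \<in> N" "Y y1 = {w1, r}" "w1 \<noteq> r" "w1 \<sim> w2"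
      "Y y2 = {w2}" "nbrs V s = {r, y}"
proof -
  note D = dangerD[OF assms]
  have Yy: "Y y = {p, s}" and nbq: "nbrs V q = {p, r}" and alt: "nbrs V r = {q, s} \<or> nbrs V s = {r, y}"
    using assms(2) by (auto simp: danger_def)
  note p = Y_D[OF assms(1) D(1)] and s = Y_D[OF assms(1) D(2)] and y = N_D[OF assms(1)]
  have adj_q: "v \<sim> q \<Longrightarrow> v \<in> V \<Longrightarrow> v = p \<or> v = r" for v
    using nbq adj_sym[of v q] nbrs_memI[of v V q] by auto
  have py: "y' = y" if "y' \<in> N" "p \<in> Y y'" for y'
    using Y_inj[OF that(1) assms(1), of p] Y_D[OF that] p by blast
  have qN: "\<not> q \<sim> y'" if "y' \<in> N" for y'
    using adj_q[of y'] N_D[OF that] D(12) p(5) adj_sym by blast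
  have qx: "q \<noteq> x" using D(10) by auto
  show thesis
  proof (cases rule: link_cases[OF D(3) qx D(11) qN, case_names 1 single pentagon])
    case 1
    then show ?case by simp
  next
    case (single y' w)
    have "w \<in> Y y'" using single by simp
    then have "w = p \<or> w = r" using adj_q[of w] single Y_D(1)[of y' w] adj_sym by blast
    then show thesis
    proof
      assume "w = p"
      then have "y' = y" using py single by simp
      then show thesis using single Yy D(10) \<open>w = p\<close> by auto
    next
      assume "w = r"
      then show thesis using single danger_not_single[OF assms] by blast
    qed
  next
    case (pentagon y1 w1 y2 w2)
    have wr: "w1 \<noteq> r" "w2 \<noteq> r" "w1 \<noteq> p" "w2 \<noteq> p"
      using pentagon(7,8) D(6,7) adj_sym by blast+
    \<comment> \<open>A pentagon through \<open>y\<close> uses \<open>s\<close>, which thereby gets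
      a third neighbour \<open>w\<close>; so it is \<open>r\<close> that has degree two.\<close>
    have key: thesis if a: "a \<in> N" "a = y" "b \<in> N" "a \<noteq> b" "v \<in> Y a" "w \<in> Y b" "v \<sim> w"
      "v \<noteq> p" "w \<noteq> r" "\<And>z. z \<in> Y b \<Longrightarrow> z = w \<or> q \<sim> z" for a b v w
    proof -
      have v: "v = s" using a Yy by auto
      have wy: "w \<noteq> y" using a Y_D(7)[of b w] by auto
      have wV: "w \<in> V" using a Y_D by blast
      have "w \<in> nbrs V s" using a v wV by (auto simp: nbrs_def)
      then have nr: "nbrs V r = {q, s}" using alt a wy by auto
      have "z = w" if z: "z \<in> Y b" for z
      proof (rule ccontr)
        assume "z \<noteq> w"
        then have "q \<sim> z" using a(10) z by blast
        then have "z = p \<or> z = r" using adj_q[of z] adj_sym z a Y_D by blast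
        moreover have "z \<noteq> p" using py[of b] a z by auto
        moreover have "z \<noteq> r"
        proof
          assume "z = r"
          then have "b \<in> nbrs V r" using Y_D(4)[OF a(3) z] N_D[OF a(3)] by (auto simp: nbrs_def)
          then have "b = q \<or> b = s" using nr by auto
          then show False using D(11) s(5) N_D[OF a(3)] by auto
        qed
        ultimately show False by blast
      qed
      then have "Y b = {w}" using a by blast
      then show thesis using deg2[of b w] a v nr wy by blast
    qed
    show thesis
    proof (cases "y1 = y \<or> y2 = y")
      case True
      then show thesis
        using key[of y1 y2 w1 w2] key[of y2 y1 w2 w1] pentagon wr adj_sym by metis
    next
      case False
      have sub: "z = w1 \<or> z = r" if "z \<in> Y y1" for z
        using pentagon(11)[OF that] adj_q[of z] adj_sym that pentagon(1) Y_D(1) py[of y1] False by blast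
      have sub2: "z = w2 \<or> z = r" if "z \<in> Y y2" for z
        using pentagon(12)[OF that] adj_q[of z] adj_sym that pentagon(2) Y_D(1) py[of y2] False by blast
      have rboth: "\<not> (r \<in> Y y1 \<and> r \<in> Y y2)"
        using Y_inj[of y1 y2 r] pentagon(1-3) Y_D(4) D(10) by auto
      \<comment> \<open>A neighbour of \<open>r\<close> in \<open>N\<close> is a third one besides
        \<open>q\<close> and \<open>s\<close>, so \<open>s\<close> must have degree two.\<close>
      have rY: "nbrs V s = {r, y}" if "b \<in> N" "r \<in> Y b" for b
      proof -
        have "b \<in> nbrs V r" using Y_D(4)[OF that] N_D[OF that(1)] by (auto simp: nbrs_def)
        moreover have "b \<noteq> q" "b \<noteq> s" using D(11) s(5) N_D[OF that(1)] by auto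
        ultimately show ?thesis using alt by auto
      qed
      have "r \<in> Y y1 \<or> r \<in> Y y2"
      proof (rule ccontr)
        assume "\<not> ?thesis"
        then have "Y y1 = {w1}" "Y y2 = {w2}" using sub sub2 pentagon(4,5) by auto
        then show False using Y_singletons pentagon(1,2,6) by blast
      qed
      then show thesis
      proof
        assume r: "r \<in> Y y1"
        have "Y y1 = {w1, r}" "Y y2 = {w2}" using sub sub2 pentagon(4,5) r rboth by auto
        then show thesis using deg3[of y1 y2 w1 w2] pentagon(1,2,6) wr rY r by blast
      next
        assume r: "r \<in> Y y2"
        have "Y y2 = {w2, r}" "Y y1 = {w1}" using sub sub2 pentagon(4,5) r rboth by auto
        then show thesis using deg3[of y2 y1 w2 w1] pentagon(1,2) wr rY r adj_sym[OF pentagon(6)] by blast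
      qed
    qed
  qed
qed

text \<open>In the other case of \<open>danger_cases\<close>, the mirror image of the pentagon is dangerous as well.\<close>
lemma danger_deg3: 
  assumes "y \<in> N" "danger y p s q r u"
  obtains y1 w1 y2 w2 where "y1 \<in> N" "y2 \<in> N" "Y y1 = {w1, r}" "w1 \<noteq> r" "w1 \<sim> w2"
    "Y y2 = {w2}" "nbrs V s = {r, y}"
proof (cases rule: danger_cases[OF assms, case_names deg2 deg3])
  case (deg2 b w)
  note D = dangerD[OF assms]
  have Yy: "Y y = {p, s}" and nbq: "nbrs V q = {p, r}"
    using assms(2) by (auto simp: danger_def)
  note p = Y_D[OF assms(1) D(1)] and s = Y_D[OF assms(1) D(2)]
  have w: "w \<in> Y b" using deg2 by simp
  have d': "danger y s p r q w"
    unfolding danger_def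
    using Yy nbq deg2(3-6) D(4) adj_sym[OF D(6)] Y_D(1)[OF deg2(1) w]
    by (auto simp: nbrs_def insert_commute)
  show thesis
  proof (cases rule: danger_cases[OF assms(1) d', case_names deg2' deg3'])
    case (deg2' b' w')
    have w': "w' \<in> Y b'" using deg2' by simp
    \<comment> \<open>Otherwise \<open>y p w s\<close> would be a 4-cycle.\<close>
    have "b \<noteq> b'"
    proof
      assume "b = b'"
      then have "w = w'" using deg2 deg2' by simp
      then show False
        using no_commons[of y p s w] p s deg2(3) deg2'(3) D(10) adj_sym[of s w] adj_sym[of p w']
          deg2(6) by auto
    qed
    \<comment> \<open>\<open>s\<close> dominates \<open>Y b = {w}\<close> and \<open>p\<close>
      dominates \<open>Y b' = {w'}\<close>, so the exchange applies to \<open>b\<close> and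
      \<open>b'\<close>.\<close>
    moreover have "indep {p, s}"
      using D(17) adj_sym[of s p] adj_irrefl by (auto simp: indep_def)
    ultimately show thesis
      using exchange[of "{p, s}" b b'] deg2(1-3) deg2'(1-3) p(8) s(8) by auto
  next
    case deg3'
    then have "nbrs V p = {q, y}" by simp
    moreover have "u \<in> nbrs V p" using assms(2) by (simp add: danger_def)
    ultimately show thesis using D(10) by auto
  qed
next
  case deg3
  then show thesis using that by blast
qed

text \<open>Read off from goodness of \<open>y\<close> in \<open>V - {x}\<close>, where its
  neighbours form \<open>Y y\<close>. On a basic pentagon, a cycle neighbour of \<open>y\<close>
  with a further neighbour gives \<open>danger\<close> when \<open>y\<close> is at \<open>b\<close>,
  \<open>d\<close> or \<open>e\<close>; all else is \<open>harmless\<close>.\<close>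

lemma N_type:
  assumes "y \<in> N"
  shows "(\<exists>w. Y y = {w}) \<or> (\<exists>z\<in>Y y. nbrs V z = {y}) \<or> harmless y \<or> (\<exists>p s q r u. danger y p s q r u)"
proof -
  let ?V = "V - {x}"
  note y = N_D[OF assms]
  have Yy: "nbrs ?V y = Y y" by (auto simp: nbrs_def Y_def)
  have pent: ?thesis if C5: "basic_pentagon ?V a b c d e" and y_in: "y \<in> {a, b, e}" for a b c d e
  proof -
    note C = basic_pentagonD[OF C5]
    have V: "a \<in> V" "b \<in> V" "c \<in> V" "d \<in> V" "e \<in> V" "x \<notin> {a, b, c, d, e}"
      using C by auto
    \<comment> \<open>Pentagon vertices are within distance two of \<open>y\<close>, so those other
      than \<open>y\<close> do not see \<open>x\<close>, and their degrees in \<open>V - {x}\<close>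
      persist in \<open>V\<close>.\<close>
    have n1: "\<not> t \<sim> x" if "t \<sim> y" for t
      using no_triangle[of t y x] that y adj_sym[of t x] by blast
    have n2: "\<not> t \<sim> x" if "t \<sim> t'" "t' \<sim> y" "t \<noteq> y" "t' \<noteq> x" for t t'
      using no_square[of t t' y x] that y adj_sym[of t x] by blast
    note C' = C(6-10)[THEN adj_sym]
    show ?thesis
    proof (cases "y = a")
      case True
      have "\<not> b \<sim> x" "\<not> e \<sim> x" using n1 True C C' by blast+
      then have "nbrs V b = {a, c}" "nbrs V e = {d, a}"
        using nbrs_delete[of b] nbrs_delete[of e] C(12-14) by simp_all
      moreover have "b \<in> Y y" "e \<in> Y y" using True Y_I[OF assms] V C C' by auto
      ultimately have "harmless y"
        using True C(8,11) by (intro harmlessI[of b y e c d]) (auto simp: insert_commute)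
      then show ?thesis by blast
    next
      case ya: False
      show ?thesis
      proof (cases "y = b")
        case True
        have nx: "\<not> a \<sim> x" "\<not> c \<sim> x" using n1 True C C' by blast+
        have nx': "\<not> d \<sim> x" using n2[of d c] True C C' V by auto
        have nx'': "\<not> e \<sim> x" using n2[of e a] True C C' V by auto
        have nbs: "nbrs V e = {d, a}" "nbrs V d = {c, e}" 
          using nbrs_delete[of e] nbrs_delete[of d] nx' nx'' C(12-14) by simp_all
        have Y: "Y y = {a, c}" using True Yy C by simp
        have sub: "{b, e} \<subseteq> nbrs V a" "{b, d} \<subseteq> nbrs V c"
          using V C C' by (auto simp: nbrs_def)
        show ?thesis
        proof (cases "nbrs V a = {b, e} \<and> nbrs V c = {b, d}")
          case deg2: True
          have "harmless y"
            using True deg2 Y C(11) C'(4) by (intro harmlessI[of a y c e d]) auto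
          then show ?thesis by blast
        next
          case False
          then consider u where "u \<in> nbrs V a" "u \<notin> {b, e}" | u where "u \<in> nbrs V c" "u \<notin> {b, d}"
            using sub by blast
          then show ?thesis
          proof cases
            case 1
            then have "danger y a c e d u"
              unfolding danger_def using True Y nbs V C C' by (auto simp: insert_commute)
            then show ?thesis by blast
          next
            case 2
            then have "danger y c a d e u"
              unfolding danger_def using True Y nbs V C C' by (auto simp: insert_commute)
            then show ?thesis by blast
          qed
        qed
      next
        case False
        then have ye: "y = e" using ya y_in by auto
        have nx: "\<not> a \<sim> x" "\<not> d \<sim> x" using n1 ye C C' by blast+
        have nx': "\<not> b \<sim> x" using n2[of b a] ye C C' V by auto
        have nbs: "nbrs V b = {a, c}" "nbrs V d = {c, e}" 
          using nbrs_delete[of b] nbrs_delete[of d] nx nx' C(12-14) by simp_all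
        have Y: "Y y = {a, d}" using ye Yy C by auto
        have sub: "{e, b} \<subseteq> nbrs V a" using V C C' by (auto simp: nbrs_def)
        show ?thesis
        proof (cases "nbrs V a = {e, b}")
          case True
          have "harmless y"
            using True ye Y C(7,11) nbs
            by (intro harmlessI[of a y d b c]) (auto simp: insert_commute)
          then show ?thesis by blast
        next
          case False
          then obtain u where "u \<in> nbrs V a" "u \<notin> {e, b}" using sub by blast
          then have "danger y a d b c u"
            unfolding danger_def using ye Y nbs V C C' by (auto simp: insert_commute)
          then show ?thesis by blast
        qed
      qed
    qed
  qed
  have "y \<in> ?V" "nbrs ?V y \<noteq> {}" using y Yy Y_nonempty[OF assms] by auto
  then consider l u where "l \<in> ?V" "l = y \<or> l \<sim> y" "nbrs ?V l = {u}"
    | a b c d e where "basic_pentagon ?V a b c d e" "y \<in> {a, b, c, d, e}"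
    using good_del[of y] unfolding good_def by blast
  then show ?thesis
  proof cases
    case 1
    show ?thesis
    proof (cases "l = y")
      case True
      then show ?thesis using 1 Yy by auto
    next
      case False
      then have l: "l \<in> Y y" using 1 Y_I[OF assms, of l] adj_sym[of l y] by blast
      then have "nbrs V l = {u}" using 1 nbrs_delete[of l] Y_D(5)[OF assms l] by simp
      moreover have "y \<in> nbrs V l" using Y_D[OF assms l] y by (auto simp: nbrs_def)
      ultimately show ?thesis using l by auto
    qed
  next
    case 2
    then have "y \<in> {a, b, e} \<or> y \<in> {c, b, d}" by auto
    then show ?thesis using pent[of a b c d e] pent[of c b a e d] 2(1) basic_pentagon_sym[OF 2(1)] by blast
  qed
qed

text \<open>Danger would spread to \<open>y1\<close>: \<open>r\<close> has degree at least three and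
  \<open>w1\<close> has the neighbour \<open>w2\<close>, which excludes every other outcome of
  \<open>N_type\<close>. A second use of \<open>danger_deg3\<close> puts \<open>w2\<close> into a
  two-element \<open>Y y3\<close>, contrary to \<open>Y y2 = {w2}\<close>.\<close>

lemma not_danger: "y \<in> N \<Longrightarrow> \<not> danger y p s q r u"
proof
  assume y: "y \<in> N" and dy: "danger y p s q r u"
  note D = dangerD[OF y dy]
  obtain y1 w1 y2 w2 where y12: "y1 \<in> N" "y2 \<in> N" "Y y1 = {w1, r}" "w1 \<noteq> r" "w1 \<sim> w2"
    "Y y2 = {w2}" by (rule danger_deg3[OF y dy])
  have w: "w1 \<in> Y y1" "w2 \<in> Y y2" "r \<in> Y y1" using y12 by auto
  note w1 = Y_D[OF y12(1) w(1)] and w2 = Y_D[OF y12(2) w(2)] and r = Y_D[OF y12(1) w(3)]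
  have w2nb: "w2 \<in> nbrs V w1" using y12 w2 by (auto simp: nbrs_def)
  have nbr: "{q, s, y1} \<subseteq> nbrs V r" 
    using D(3,7,8) Y_D(1)[OF y D(2)] r N_D[OF y12(1)] adj_sym[of q r] by (auto simp: nbrs_def)
  have y1qs: "y1 \<noteq> q" "y1 \<noteq> s" "q \<noteq> s"
    using N_D[OF y12(1)] D(11) Y_D(5)[OF y D(2)] D(10) by auto
  have w2y1: "w2 \<noteq> y1" using w2(7) y12(1) by blast
  show False
  proof (rule disjE[OF N_type[OF y12(1)]], goal_cases)
    case 1
    then show False using y12(3,4) by auto
  next
    case 2
    then show False
    proof (elim disjE bexE exE)
      fix z assume "z \<in> Y y1" "nbrs V z = {y1}"
      then show False using y12(3) w2nb nbr y1qs w2y1 by auto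
    next
      assume "harmless y1"
      then obtain p' s' q' r' where h: "p' \<in> Y y1" "s' \<in> Y y1" "p' \<noteq> s'"
        "nbrs V p' = {y1, q'}" "nbrs V s' = {y1, r'}" unfolding harmless_def by blast
      then have "nbrs V r = {y1, q'} \<or> nbrs V r = {y1, r'}" using y12(3) by auto
      then show False using nbr y1qs by auto
    next
      fix p' s' q' r' u' assume d': "danger y1 p' s' q' r' u'"
      note D' = dangerD[OF y12(1) d']
      obtain y3 w3 where d3: "y3 \<in> N" "Y y3 = {w3, r'}" "w3 \<noteq> r'" "nbrs V s' = {r', y1}"
        by (rule danger_deg3[OF y12(1) d'])
      \<comment> \<open>\<open>s'\<close> has degree two and \<open>r\<close> does not, so
        \<open>s'\<close> is \<open>w1\<close> and its neighbour \<open>w2\<close> is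
        \<open>r'\<close>.\<close>
      have "s' \<noteq> r" using d3(4) nbr y1qs by auto
      then have "s' = w1" using D'(2) y12(3) by auto
      then have "w2 = r'" using d3(4) w2nb w2y1 by auto
      then have "w2 \<in> Y y3" using d3 by simp
      then have "y3 = y2" using Y_inj[of y3 y2 w2] d3(1) y12(2) w2 Y_D(4) by blast
      then show False using d3 y12(6) by auto
    qed
  qed
qed

lemma spare_free_vertex_False: False
proof -
  \<comment> \<open>The forced choices are pairwise compatible; every other neighbour of \<open>x\<close> can be served greedily.\<close>
  define T0 where "T0 = {w. \<exists>y\<in>N. Y y = {w}}"
  have T0: "T0 \<subseteq> link V x" "indep T0"
  proof -
    show "T0 \<subseteq> link V x" using Y_D(8) unfolding T0_def by blast
    show "indep T0" using Y_singletons unfolding T0_def indep_def by blast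
  qed
  have "\<exists>T. T0 \<subseteq> T \<and> T \<subseteq> link V x \<and> indep T \<and> (\<forall>y\<in>F. Y y \<inter> T \<noteq> {})"
    if "F \<subseteq> N" "finite F" for F
    using that(2,1)
  proof (induction F)
    case empty
    then show ?case using T0 by blast
  next
    case (insert y F)
    then obtain T where T: "T0 \<subseteq> T" "T \<subseteq> link V x" "indep T" "\<forall>y\<in>F. Y y \<inter> T \<noteq> {}"
      by blast
    have y: "y \<in> N" using insert by simp
    show ?case
    proof (cases "Y y \<inter> T = {}")
      case False
      then show ?thesis using T by (intro exI[of _ T]) auto
    next
      case True
      \<comment> \<open>As \<open>T\<close> avoids \<open>y\<close>, a candidate in
        \<open>Y y\<close> can be blocked only by its other neighbours.\<close>
      have "y \<notin> T" using y T(2) by (auto simp: nbrs_def link_def)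
      have "\<exists>t\<in>Y y. \<forall>z\<in>T. \<not> z \<sim> t"
        using N_type[OF y] not_danger[OF y]
      proof (elim disjE)
        assume "\<exists>w. Y y = {w}"
        then obtain w where "Y y = {w}" by blast
        then have "w \<in> T" using T(1) y unfolding T0_def by blast
        then show ?thesis using \<open>Y y = {w}\<close> True by auto
      next
        assume "\<exists>z\<in>Y y. nbrs V z = {y}"
        then obtain z where z: "z \<in> Y y" "nbrs V z = {y}" by blast
        have "\<not> t \<sim> z" if "t \<in> T" for t
        proof
          assume "t \<sim> z"
          then have "t \<in> nbrs V z" using that T(2) adj_sym[of t z] by (auto simp: nbrs_def link_def)
          then show False using z that \<open>y \<notin> T\<close> by auto
        qed
        then show ?thesis using z by blast
      next
        assume "harmless y"
        then obtain p s q r where h: "p \<in> Y y" "s \<in> Y y"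
          "nbrs V p = {y, q}" "nbrs V s = {y, r}" "q \<sim> r" unfolding harmless_def by blast
        have *: "t = q" if "t \<in> T" "t \<sim> p" for t
        proof -
          have "t \<in> nbrs V p" using that T(2) adj_sym[of t p] by (auto simp: nbrs_def link_def)
          then show ?thesis using h that \<open>y \<notin> T\<close> by auto
        qed
        have **: "t = r" if "t \<in> T" "t \<sim> s" for t
        proof -
          have "t \<in> nbrs V s" using that T(2) adj_sym[of t s] by (auto simp: nbrs_def link_def)
          then show ?thesis using h that \<open>y \<notin> T\<close> by auto
        qed
        \<comment> \<open>\<open>p\<close> is blocked only by \<open>q\<close> and \<open>s\<close>
          only by \<open>r\<close>, and these are adjacent.\<close>
        have "q \<notin> T \<or> r \<notin> T" using T(3) h(5) by (auto simp: indep_def)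
        then show ?thesis using h(1,2) * ** by blast
      qed blast
      then obtain t where t: "t \<in> Y y" "\<forall>z\<in>T. \<not> z \<sim> t" by blast
      then have "indep (insert t T)" using T(3) by (simp add: indep_insert)
      moreover have "insert t T \<subseteq> link V x" using Y_D(8)[OF y t(1)] T(2) by simp
      ultimately show ?thesis using T(1,4) t(1) by (intro exI[of _ "insert t T"]) auto
    qed
  qed
  from this[of N] obtain T where "T \<subseteq> link V x" "indep T" "\<forall>y\<in>N. Y y \<inter> T \<noteq> {}"
    using fin by (auto simp: nbrs_def)
  then show False using no_transversal by blast
qed

end

section \<open>All vertices of a vertex decomposable set\<close>

context shed_vertex
begin

text \<open>The negations of the two outcomes are the assumptions of
  \<open>spare_free_vertex\<close>.\<close>

lemma structure_at:
  obtains (pendant) l where "l \<in> N" "Y l = {}"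
  | (pentagon) y1 w1 y2 w2 where "y1 \<in> N" "y2 \<in> N" "Y y1 = {w1}" "Y y2 = {w2}" "w1 \<sim> w2"
proof (rule ccontr)
  assume "\<not> thesis"
  then interpret spare_free_vertex adj V x
    using pendant pentagon by unfold_locales blast+
  show False by (rule spare_free_vertex_False)
qed

section \<open>Goodness in \<open>V\<close> from the structure at \<open>x\<close>\<close>

lemma second_neighbour:
  assumes "y \<in> N" "w \<in> Y y" "u \<in> V" "u \<sim> w" "u \<noteq> y"
  shows "u \<in> link V x"
proof -
  note w = Y_D[OF assms(1,2)]
  have "u \<noteq> x" using w assms(4) by blast
  \<comment> \<open>Otherwise \<open>x y w u\<close> would be a 4-cycle.\<close>
  moreover have "\<not> x \<sim> u"
    using Y_inj[OF assms(1), of u w] w assms(3-5) adj_sym[of u w] nbrs_memI[of u V x] by blast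
  ultimately show ?thesis using assms(3) by (auto simp: link_def)
qed

lemma nbrs_neighbour: "y \<in> N \<Longrightarrow> nbrs V y = insert x (Y y)"
  using N_D[of y] nbrs_memI[OF xV, of y] unfolding Y_def by blast

lemma good_basic_pentagon: "basic_pentagon V a b c d e \<Longrightarrow> v \<in> {a, b, c, d, e} \<Longrightarrow> good V v"
  unfolding good_def by blast

lemma good_leaf: "l \<in> V \<Longrightarrow> nbrs V l = {u} \<Longrightarrow> good V l \<and> good V u"
  unfolding good_def using nbrs_memD[of u V l] by blast

text \<open>If \<open>w1\<close> and \<open>w2\<close> both had neighbours \<open>u1\<close>,
  \<open>u2\<close> off the pentagon, these would be nonadjacent, and \<open>{u1, u2}\<close> would
  allow the exchange at \<open>y1\<close> and \<open>y2\<close>. So one of \<open>w1\<close>,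
  \<open>w2\<close> has degree two and the pentagon is basic.\<close>

lemma pentagon_good:
  assumes "y1 \<in> N" "y2 \<in> N" "Y y1 = {w1}" "Y y2 = {w2}" "w1 \<sim> w2"
    and v: "v \<in> {x, y1, w1, y2, w2}"
  shows "good V v"
proof -
  have w: "w1 \<in> Y y1" "w2 \<in> Y y2" using assms by auto
  note w1 = Y_D[OF assms(1) w(1)] and w2 = Y_D[OF assms(2) w(2)]
  have ne: "y1 \<noteq> y2" using assms adj_irrefl by auto
  have nby: "nbrs V y1 = {x, w1}" "nbrs V y2 = {x, w2}" using assms(3,4) nbrs_neighbour[OF assms(1)] nbrs_neighbour[OF assms(2)] by auto
  have sub: "{y1, w2} \<subseteq> nbrs V w1" "{y2, w1} \<subseteq> nbrs V w2"
    using w1 w2 assms(5) adj_sym[OF assms(5)] N_D[OF assms(1)] N_D[OF assms(2)] by (auto simp: nbrs_def)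
  have "nbrs V w1 = {y1, w2} \<or> nbrs V w2 = {y2, w1}"
  proof (rule ccontr)
    assume "\<not> ?thesis"
    then obtain u1 u2 where "u1 \<in> nbrs V w1" "u1 \<noteq> y1" "u1 \<noteq> w2" "u2 \<in> nbrs V w2" "u2 \<noteq> y2" "u2 \<noteq> w1"
      using sub by blast
    note u = this nbrs_memD[OF this(1)] nbrs_memD[OF this(4)]
    have "{u1, u2} \<subseteq> link V x"
      using second_neighbour[OF assms(1) w(1), of u1] second_neighbour[OF assms(2) w(2), of u2] u by auto
    moreover have "\<not> u1 \<sim> u2"
      using no_square[of u1 w1 w2 u2] u assms(5) adj_sym[of u1 u2] by blast
    then have "indep {u1, u2}" using adj_irrefl adj_sym[of u2 u1] by (auto simp: indep_def)
    ultimately show False using exchange[of "{u1, u2}" y1 y2] assms(1-4) ne u by auto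
  qed
  then show ?thesis
  proof
    assume "nbrs V w1 = {y1, w2}"
    then have "basic_pentagon V x y2 w2 w1 y1"
      using nby assms(1,2) N_D[OF assms(2)] adj_sym[OF assms(5)] by (auto simp: basic_pentagon_def)
    then show ?thesis using v by (elim good_basic_pentagon) auto
  next
    assume "nbrs V w2 = {y2, w1}"
    then have "basic_pentagon V x y1 w1 w2 y2"
      using nby assms N_D[OF assms(1)] by (auto simp: basic_pentagon_def)
    then show ?thesis using v by (elim good_basic_pentagon) auto
  qed
qed

lemma good_shed_vertex: "good V x"
proof (cases rule: structure_at)
  case (pendant l)
  then show ?thesis using good_leaf[of l x] nbrs_neighbour[of l] N_D[of l] by simp
next
  case pentagon
  then show ?thesis by (intro pentagon_good[OF pentagon]) simp
qed

lemma indep_pair: "\<not> u \<sim> v \<Longrightarrow> indep {u, v}"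
  using adj_irrefl adj_sym[of v u] by (auto simp: indep_def)

text \<open>This handles a pendant edge \<open>l v\<close> of \<open>V - {x}\<close> whose leaf
  \<open>l\<close> sees \<open>x\<close>. If \<open>v\<close> has a further neighbour
  \<open>u\<close>, exchanges at \<open>l\<close> and at the vertices from
  \<open>structure_at\<close> force \<open>l\<close> and \<open>v\<close> onto the pentagon found
  there.\<close>

lemma good_degree_2:
  assumes "l \<in> N" "Y l = {v}"
  shows "good V l \<and> good V v"
proof (cases "nbrs V v = {l}")
  case True
  then show ?thesis using good_leaf[of v l] Y_D(1)[OF assms(1)] assms(2) by simp
next
  case False
  have vY: "v \<in> Y l" using assms by simp
  note v = Y_D[OF assms(1) vY]
  have "l \<in> nbrs V v" using v N_D[OF assms(1)] by (simp add: nbrs_def)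
  then obtain u where u: "u \<in> nbrs V v" "u \<noteq> l" using False by blast
  note u = u nbrs_memD[OF u(1)]
  have ul: "u \<in> link V x" using second_neighbour[OF assms(1) vY] u by blast
  show ?thesis
  proof (cases rule: structure_at)
    case (pendant l0)
    then show ?thesis
      using exchange[of "{u}" l0 l] assms ul u adj_irrefl by (auto simp: indep_def)
  next
    case (pentagon y1 w1 y2 w2)
    have w: "w1 \<in> Y y1" "w2 \<in> Y y2" using pentagon by auto
    note w1 = Y_D[OF pentagon(1) w(1)] and w2 = Y_D[OF pentagon(2) w(2)]
    consider "l = y1" | "l = y2" | "l \<noteq> y1" "l \<noteq> y2" by blast
    then show ?thesis
    proof cases
      case 3
      \<comment> \<open>Otherwise \<open>{u, w1}\<close> would dominate \<open>Y l\<close> and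
        \<open>Y y2\<close>. With the same for \<open>w2\<close>, a triangle arises.\<close>
      have "u \<sim> w1"
      proof (rule ccontr)
        assume "\<not> u \<sim> w1"
        then show False
          using exchange[of "{u, w1}" y2 l] indep_pair[of u w1] ul w1 u pentagon assms 3 by auto
      qed
      moreover have "u \<sim> w2"
      proof (rule ccontr)
        assume "\<not> u \<sim> w2"
        then show False
          using exchange[of "{u, w2}" y1 l] indep_pair[of u w2] ul w2 u pentagon assms 3
            adj_sym[OF pentagon(5)] by auto
      qed
      ultimately show ?thesis using no_triangle[of u w1 w2] pentagon(5) adj_sym[of u w2] by blast
    next
      case 1
      then have "v = w1" using pentagon assms by simp
      then show ?thesis using pentagon_good[OF pentagon] 1 by simp
    next
      case 2
      then have "v = w2" using pentagon assms by simp
      then show ?thesis using pentagon_good[OF pentagon] 2 by simp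
    qed
  qed
qed

text \<open>On the pentagon \<open>y p q t s\<close>, a further neighbour \<open>u\<close> of
  \<open>p\<close> is not adjacent to \<open>t\<close>, so \<open>{u, t}\<close> is independent and
  dominates \<open>Y y\<close>. \<open>structure_at\<close> supplies a partner for the
  exchange.\<close>

lemma degree_3_path:
  assumes "y \<in> N" "Y y = {p, s}" "p \<noteq> s" "p \<sim> q" "q \<sim> t" "t \<sim> s" "t \<in> V" "t \<noteq> y"
  shows "nbrs V p \<subseteq> {y, q}"
proof (rule ccontr)
  assume "\<not> nbrs V p \<subseteq> {y, q}"
  then obtain u where u: "u \<in> nbrs V p" "u \<noteq> y" "u \<noteq> q" by blast
  note u = u nbrs_memD[OF u(1)]
  have ps: "p \<in> Y y" "s \<in> Y y" using assms by auto
  note p = Y_D[OF assms(1) ps(1)] and s = Y_D[OF assms(1) ps(2)]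
  have "p \<noteq> t" using no_triangle[of y p s] p s assms(6) by blast
  then have ut: "\<not> u \<sim> t"
    using no_square[of u p q t] u assms(4,5) adj_sym[of u t] by blast
  have link: "u \<in> link V x" "t \<in> link V x"
    using second_neighbour[OF assms(1) ps(1), of u] second_neighbour[OF assms(1) ps(2), of t]
      u assms by auto
  show False
  proof (cases rule: structure_at)
    case (pendant l)
    then show ?thesis
      using exchange[of "{u, t}" l y] indep_pair[OF ut] link assms u by auto
  next
    case (pentagon y1 w1 y2 w2)
    have w: "w1 \<in> Y y1" "w2 \<in> Y y2" using pentagon by auto
    note w1 = Y_D[OF pentagon(1) w(1)] and w2 = Y_D[OF pentagon(2) w(2)]
    have ne: "y1 \<noteq> y" "y2 \<noteq> y" "y1 \<noteq> y2"
      using pentagon assms(2,3) adj_irrefl by auto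
    have 1: "u \<sim> w1 \<or> t \<sim> w1"
    proof (rule ccontr)
      assume "\<not> ?thesis"
      then have "indep {w1, u, t}" using indep_pair[OF ut] by (auto simp: indep_insert)
      then show False
        using exchange[of "{w1, u, t}" y2 y] link w1 u pentagon assms ne by auto
    qed
    have 2: "u \<sim> w2 \<or> t \<sim> w2"
    proof (rule ccontr)
      assume "\<not> ?thesis"
      then have "indep {w2, u, t}" using indep_pair[OF ut] by (auto simp: indep_insert)
      then show False
        using exchange[of "{w2, u, t}" y1 y] link w2 u pentagon assms ne
          adj_sym[OF pentagon(5)] by auto
    qed
    \<comment> \<open>Now \<open>{u, t}\<close> dominates both \<open>w1\<close> and
      \<open>w2\<close>, so \<open>y1\<close> and \<open>y2\<close> can be exchanged for
      \<open>x\<close>.\<close>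
    then show False
      using exchange[of "{u, t}" y1 y2] 1 indep_pair[OF ut] link pentagon ne by auto
  qed
qed

text \<open>Trouble arises only if \<open>x\<close> sees one of \<open>b\<close>, \<open>d\<close>,
  \<open>e\<close>. Then \<open>degree_3_path\<close> ensures that both cycle neighbours of that
  vertex have degree two, and a rotation or reflection moves it to a position where large degree is
  allowed.\<close>

lemma basic_pentagon_lift:
  assumes "basic_pentagon (V - {x}) a b c d e"
  shows "\<exists>a' b' c' d' e'. basic_pentagon V a' b' c' d' e' \<and> {a, b, c, d, e} = {a', b', c', d', e'}"
proof -
  have far: "\<not> t \<sim> x" if "t \<sim> t'" "t' \<sim> y" "t \<noteq> y" "t' \<noteq> x" "y \<sim> x" for t t' y
    using no_square[of t t' y x] that adj_sym[of t x] by blast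
  have case_e: "\<exists>a' b' c' d' e'. basic_pentagon V a' b' c' d' e' \<and> {a, b, c, d, e} = {a', b', c', d', e'}"
    if C5: "basic_pentagon (V - {x}) a b c d e" and ex: "e \<sim> x" for a b c d e
  proof -
    note C = basic_pentagonD[OF C5] and C' = basic_pentagonD(6-10)[OF C5, THEN adj_sym]
    have V: "a \<in> V" "b \<in> V" "c \<in> V" "d \<in> V" "e \<in> V" "x \<notin> {a, b, c, d, e}"
      using C by auto
    have "\<not> d \<sim> x" using no_triangle[of d e x] C ex adj_sym[of d x] by blast
    moreover have "\<not> b \<sim> x" using far[of b a e] C C' V ex by auto
    ultimately have nbs: "nbrs V b = {a, c}" "nbrs V d = {c, e}"
      using nbrs_delete[of b] nbrs_delete[of d] C(12-14) by simp_all
    have e: "e \<in> N" using V adj_sym[OF ex] by (simp add: nbrs_def)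
    moreover have "Y e = {a, d}" using C(14) by (auto simp: Y_def nbrs_def)
    ultimately have "nbrs V a \<subseteq> {e, b}"
      using degree_3_path[of e a d b c] C V by auto
    then have "nbrs V a = {e, b}" using C C' V by (auto simp: nbrs_def)
    then have "basic_pentagon V c d e a b"
      using nbs V C by (auto simp: basic_pentagon_def insert_commute)
    then show ?thesis by (intro exI[of _ c] exI[of _ d] exI[of _ e] exI[of _ a] exI[of _ b]) auto
  qed
  note C = basic_pentagonD[OF assms] and C' = basic_pentagonD(6-10)[OF assms, THEN adj_sym]
  have V: "a \<in> V" "b \<in> V" "c \<in> V" "d \<in> V" "e \<in> V" "x \<notin> {a, b, c, d, e}"
    using C by auto
  consider "e \<sim> x" | "d \<sim> x" | "b \<sim> x" | "\<not> b \<sim> x" "\<not> d \<sim> x" "\<not> e \<sim> x" by blast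
  then show ?thesis
  proof cases
    case 1
    then show ?thesis using case_e assms by blast
  next
    case 2
    have "{a, b, c, d, e} = {c, b, a, e, d}" by auto
    then show ?thesis using case_e[OF basic_pentagon_sym[OF assms] 2] by simp
  next
    case 3
    have "\<not> d \<sim> x" "\<not> e \<sim> x" using far[of d c b] far[of e a b] C C' V 3 by auto
    then have nbs: "nbrs V d = {c, e}" "nbrs V e = {d, a}"
      using nbrs_delete[of d] nbrs_delete[of e] C(12-14) by simp_all
    have b: "b \<in> N" using V adj_sym[OF 3] by (simp add: nbrs_def)
    have Yb: "Y b = {a, c}" using C(12) by (auto simp: Y_def nbrs_def)
    have "nbrs V a \<subseteq> {b, e}" "nbrs V c \<subseteq> {b, d}"
      using degree_3_path[OF b Yb, of e d] degree_3_path[of b c a d e] b Yb C C' V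
      by (auto simp: insert_commute)
    then have "nbrs V a = {e, b}" "nbrs V c = {b, d}" using C C' V by (auto simp: nbrs_def)
    then have "basic_pentagon V b c d e a"
      using nbs V C by (auto simp: basic_pentagon_def)
    then show ?thesis by (intro exI[of _ b] exI[of _ c] exI[of _ d] exI[of _ e] exI[of _ a]) auto
  next
    case 4
    then have "basic_pentagon V a b c d e"
      using nbrs_delete[of b] nbrs_delete[of d] nbrs_delete[of e] C V by (simp add: basic_pentagon_def)
    then show ?thesis by blast
  qed
qed

lemma good_all:
  assumes "v \<in> V"
  shows "good V v"
proof (cases "v = x")
  case True
  then show ?thesis using good_shed_vertex by simp
next
  case False
  let ?V = "V - {x}"
  have "v \<in> ?V" using False assms by simp
  then consider "nbrs ?V v = {}" | l u where "l \<in> ?V" "l = v \<or> l \<sim> v" "nbrs ?V l = {u}"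
    | a b c d e where "basic_pentagon ?V a b c d e" "v \<in> {a, b, c, d, e}"
    using good_del[of v] unfolding good_def by blast
  then show ?thesis
  proof cases
    case 1
    then have "nbrs V v = {} \<or> nbrs V v = {x}" by (auto simp: nbrs_def)
    then show ?thesis using good_leaf[OF assms] by (auto simp: good_def)
  next
    case 2
    show ?thesis
    proof (cases "l \<sim> x")
      case True
      then have l: "l \<in> N" using 2 adj_sym[OF True] by (simp add: nbrs_def)
      have Yl: "Y l = {u}" using 2(3) by (auto simp: Y_def nbrs_def)
      have "v = l \<or> v = u" using 2 \<open>v \<in> ?V\<close> nbrs_memI[of v ?V l] by auto
      then show ?thesis using good_degree_2[OF l Yl] by blast
    next
      case False
      then show ?thesis using 2 nbrs_delete[OF False] unfolding good_def by auto
    qed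
  next
    case 3
    then obtain a' b' c' d' e' where "basic_pentagon V a' b' c' d' e'" "v \<in> {a', b', c', d', e'}"
      using basic_pentagon_lift[OF 3(1)] by blast
    then show ?thesis by (rule good_basic_pentagon)
  qed
qed

end

context girth5_adj
begin

theorem vdec_good:
  assumes "finite V" "vdec V" "v \<in> V"
  shows "good V v"
  using assms
proof (induction "card V" arbitrary: V v rule: less_induct)
  case less
  from less.prems(2) show ?case
  proof (cases rule: vdec.cases)
    case edgeless
    then have "nbrs V v = {}" using less.prems(3) by (auto simp: nbrs_def indep_def)
    then show ?thesis by (simp add: good_def)
  next
    case (shed x)
    have IH: "good W w" if "W \<subset> V" "vdec W" "w \<in> W" for W w
      using less.hyps[of W w] that less.prems(1) psubset_card_mono finite_subset[of W V] by auto
    have del: "good (V - {x}) w" if "w \<in> V - {x}" for w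
      using IH[of "V - {x}" w] shed that by blast
    \<comment> \<open>For an isolated \<open>x\<close>, \<open>no_dom\<close> fails, but its
      deletion changes no neighbourhood and goodness carries over.\<close>
    show ?thesis
    proof (cases "nbrs V x = {}")
      case True
      have nbrs: "nbrs (V - {x}) w = nbrs V w" if "w \<in> V" for w
        using True that adj_sym[of w x] by (auto simp: nbrs_def)
      show ?thesis
      proof (cases "v = x")
        case True
        then show ?thesis using \<open>nbrs V x = {}\<close> by (simp add: good_def)
      next
        case False
        have basic_pentagon: "basic_pentagon V a b c d e" if "basic_pentagon (V - {x}) a b c d e" for a b c d e
          using that basic_pentagonD(1-5)[OF that] by (simp add: basic_pentagon_def nbrs[symmetric])
        have "v \<in> V - {x}" using False less.prems by simp
        from del[OF this] consider "nbrs (V - {x}) v = {}"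
          | l u where "l \<in> V - {x}" "l = v \<or> l \<sim> v" "nbrs (V - {x}) l = {u}"
          | a b c d e where "basic_pentagon (V - {x}) a b c d e" "v \<in> {a, b, c, d, e}"
          unfolding good_def by blast
        then show ?thesis
        proof cases
          case 1
          then show ?thesis using nbrs[OF less.prems(3)] by (simp add: good_def)
        next
          case 2
          then show ?thesis using nbrs[of l] unfolding good_def by auto
        next
          case 3
          then show ?thesis using basic_pentagon[OF 3(1)] unfolding good_def by blast
        qed
      qed
    next
      case False
      interpret shed_vertex adj V x
      proof
        show "finite V" "well_cov V" "x \<in> V" using less.prems shed by auto
        show "\<exists>y\<in>nbrs V x. \<forall>s\<in>S. \<not> s \<sim> y" if "S \<subseteq> link V x" "indep S" for S
          using no_dominating_indep[OF less.prems(1) shed(1) vdec_well_cov[OF shed(3)] shed(2) False that] .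
        show "good (V - {x}) w" if "w \<in> V - {x}" for w using del that .
        show "good (link V w) x" if "w \<in> V" "x \<in> link V w" for w
          using IH[of "link V w" x] vdec_link[OF less.prems(2,1)] that by (auto simp: link_def)
      qed
      show ?thesis using good_all less.prems by blast
    qed
  qed
qed

end

section \<open>Transfer to digraphs\<close>

lemma girth_le_length: "induced_cycle G p \<Longrightarrow> girth G \<le> enat (length p)"
proof -
  assume "induced_cycle G p"
  then have "girth G \<le> enat (card (tail G ` set p))"
    unfolding girth_def by (intro INF_lower) simp
  also have "card (tail G ` set p) \<le> length p"
    using card_image_le[of "set p" "tail G"] card_length[of p] by simp
  finally show ?thesis by simp
qed

context graph
begin

lemma dominates_sym: "u \<rightarrow>\<^bsub>G\<^esub> v \<Longrightarrow> v \<rightarrow>\<^bsub>G\<^esub> u"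
  using sym_arcs by (auto simp: symmetric_def elim: symE)

lemma dominates_irrefl: "\<not> u \<rightarrow>\<^bsub>G\<^esub> u"
  using no_loops by (auto simp: arcs_ends_def arc_to_ends_def)

lemma dominates_arc:
  "u \<rightarrow>\<^bsub>G\<^esub> v \<Longrightarrow> \<exists>e. e \<in> arcs G \<and> tail G e = u \<and> head G e = v"
  by (auto simp: arcs_ends_def arc_to_ends_def)

lemma girth_no_triangle:
  assumes "5 \<le> girth G" "a \<rightarrow>\<^bsub>G\<^esub> b" "b \<rightarrow>\<^bsub>G\<^esub> c"
  shows "\<not> c \<rightarrow>\<^bsub>G\<^esub> a"
proof
  assume ca: "c \<rightarrow>\<^bsub>G\<^esub> a"
  obtain e1 e2 e3 where e: "e1 \<in> arcs G" "tail G e1 = a" "head G e1 = b"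
    "e2 \<in> arcs G" "tail G e2 = b" "head G e2 = c"
    "e3 \<in> arcs G" "tail G e3 = c" "head G e3 = a"
    using dominates_arc[OF assms(2)] dominates_arc[OF assms(3)] dominates_arc[OF ca] by blast
  have ne: "a \<noteq> b" "b \<noteq> c" "c \<noteq> a" using assms(2,3) ca dominates_irrefl by auto
  let ?p = "[e1, e2, e3]"
  have "a \<in> verts G" using e wellformed by auto
  then have "cycle ?p"
    unfolding cycle_def awalk_def using e ne by (intro exI[of _ a]) auto
  then have "induced_cycle G ?p"
    unfolding induced_cycle_def using e ne dominates_irrefl by (auto simp: insert_commute)
  from order_trans[OF assms(1) girth_le_length[OF this]] show False
    by (simp add: numeral_eq_enat)
qed

lemma girth_no_square:
  assumes "5 \<le> girth G" "a \<rightarrow>\<^bsub>G\<^esub> b" "b \<rightarrow>\<^bsub>G\<^esub> c" "c \<rightarrow>\<^bsub>G\<^esub> d" "d \<rightarrow>\<^bsub>G\<^esub> a"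
  shows "a = c \<or> b = d"
proof (rule ccontr)
  assume "\<not> ?thesis"
  then have ne: "a \<noteq> c" "b \<noteq> d" by auto
  obtain e1 e2 e3 e4 where e: "e1 \<in> arcs G" "tail G e1 = a" "head G e1 = b"
    "e2 \<in> arcs G" "tail G e2 = b" "head G e2 = c"
    "e3 \<in> arcs G" "tail G e3 = c" "head G e3 = d"
    "e4 \<in> arcs G" "tail G e4 = d" "head G e4 = a"
    using assms(2-5)[THEN dominates_arc] by blast
  have ne': "a \<noteq> b" "b \<noteq> c" "c \<noteq> d" "d \<noteq> a" using assms(2-5) dominates_irrefl by auto
  \<comment> \<open>A chord would create a triangle; hence the 4-cycle is induced.\<close>
  have chord: "\<not> a \<rightarrow>\<^bsub>G\<^esub> c" "\<not> c \<rightarrow>\<^bsub>G\<^esub> a" "\<not> b \<rightarrow>\<^bsub>G\<^esub> d" "\<not> d \<rightarrow>\<^bsub>G\<^esub> b"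
    using girth_no_triangle[OF assms(1)] assms(2-5) by blast+
  let ?p = "[e1, e2, e3, e4]"
  have "a \<in> verts G" using e wellformed by auto
  then have "cycle ?p"
    unfolding cycle_def awalk_def using e ne ne' by (intro exI[of _ a]) auto
  then have "induced_cycle G ?p"
    unfolding induced_cycle_def using e ne ne' chord dominates_irrefl by (auto simp: insert_commute)
  from order_trans[OF assms(1) girth_le_length[OF this]] show False
    by (simp add: numeral_eq_enat)
qed

interpretation adj: simple_adj "\<lambda>u v. u \<rightarrow>\<^bsub>G\<^esub> v"
  using dominates_sym dominates_irrefl by unfold_locales

section \<open>Induced subgraphs as vertex sets\<close>

lemma dominates_induce: "u \<rightarrow>\<^bsub>G \<restriction> S\<^esub> v \<longleftrightarrow> u \<in> S \<and> v \<in> S \<and> u \<rightarrow>\<^bsub>G\<^esub> v"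
  by (auto simp: arcs_ends_def arc_to_ends_def)

lemma delete_verts_induce: "delete_verts (G \<restriction> S) T = G \<restriction> (S - T)"
  by (auto simp: delete_verts_def induce_subgraph_def)

lemma delete_closed_nbhd_induce:
  assumes "x \<in> S"
  shows "delete_verts (G \<restriction> S) (closed_nbhd (G \<restriction> S) x) = G \<restriction> adj.link S x"
proof -
  have "S - closed_nbhd (G \<restriction> S) x = adj.link S x"
    using assms by (auto simp: closed_nbhd_def nbhd_def dominates_induce adj.link_def)
  then show ?thesis by (simp add: delete_verts_induce)
qed

lemma independent_set_induce: "independent_set (G \<restriction> S) M \<longleftrightarrow> M \<subseteq> S \<and> adj.indep M"
  by (auto simp: independent_set_def adj.indep_def dominates_induce)

lemma maximal_independent_set_induce:
  "maximal_independent_set (G \<restriction> S) M \<longleftrightarrow> adj.max_indep S M"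
proof
  assume M: "maximal_independent_set (G \<restriction> S) M"
  have "\<exists>s\<in>M. s \<rightarrow>\<^bsub>G\<^esub> v" if "v \<in> S - M" for v
  proof (rule ccontr)
    assume "\<not> ?thesis"
    then have "independent_set (G \<restriction> S) (insert v M)"
      using M that
      by (simp add: maximal_independent_set_def independent_set_induce adj.indep_insert)
    then have "M = insert v M" using M unfolding maximal_independent_set_def by blast
    then show False using that by blast
  qed
  then show "adj.max_indep S M"
    using M by (simp add: maximal_independent_set_def independent_set_induce adj.max_indep_def)
next
  assume M: "adj.max_indep S M"
  have "M = T" if "T \<subseteq> S" "adj.indep T" "M \<subseteq> T" for T
    using M that unfolding adj.max_indep_def adj.indep_def by blast
  then show "maximal_independent_set (G \<restriction> S) M"
    using M by (simp add: maximal_independent_set_def independent_set_induce adj.max_indep_def)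
qed

lemma well_covered_induce: "well_covered (G \<restriction> S) \<longleftrightarrow> adj.well_cov S"
  by (simp add: well_covered_def adj.well_cov_def maximal_independent_set_induce)

lemma arcs_induce_empty: "arcs (G \<restriction> S) = {} \<longleftrightarrow> adj.indep S"
  unfolding adj.indep_def
  unfolding arcs_ends_def arc_to_ends_def by auto

text \<open>Deletions and links of \<open>G \<restriction> S\<close> again have the form
  \<open>G \<restriction> S'\<close>, so the two inductive definitions run in parallel.\<close>

lemma vertex_decomposable_induce: "vertex_decomposable (G \<restriction> S) \<longleftrightarrow> adj.vdec S"
proof
  assume "vertex_decomposable (G \<restriction> S)"
  then show "adj.vdec S"
  proof (induction "G \<restriction> S" arbitrary: S rule: vertex_decomposable.induct)
    case no_edges
    then show ?case using adj.vdec.edgeless well_covered_induce arcs_induce_empty by blast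
  next
    case (shedding x)
    then have x: "x \<in> S" by simp
    show ?case
      using adj.vdec.shed[of S x] shedding.hyps(1,4,6) x
        well_covered_induce delete_verts_induce delete_closed_nbhd_induce[OF x] by simp
  qed
next
  assume "adj.vdec S"
  then show "vertex_decomposable (G \<restriction> S)"
  proof (induction rule: adj.vdec.induct)
    case (edgeless V)
    then show ?case
      using vertex_decomposable.no_edges well_covered_induce arcs_induce_empty by blast
  next
    case (shed V x)
    show ?case
    proof (rule vertex_decomposable.shedding[of _ x])
      show "well_covered (G \<restriction> V)" "x \<in> verts (G \<restriction> V)"
        using shed by (simp_all add: well_covered_induce)
      show "vertex_decomposable (delete_verts (G \<restriction> V) {x})"
        using shed by (simp only: delete_verts_induce)
      show "vertex_decomposable (delete_verts (G \<restriction> V) (closed_nbhd (G \<restriction> V) x))"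
        using shed by (simp only: delete_closed_nbhd_induce)
    qed
  qed
qed

lemma induce_verts: "G \<restriction> verts G = G"
proof -
  have "{e \<in> arcs G. tail G e \<in> verts G \<and> head G e \<in> verts G} = arcs G"
    using wellformed by auto
  then show ?thesis by (simp add: induce_subgraph_def)
qed

end

theorem theorem5p3:
  fixes G :: "('a, 'b) pre_digraph"
  assumes "graph G"
    and "5 \<le> girth G"
    and "vertex_decomposable G"
  shows "dominating_set G (Shed G)"
proof -
  interpret graph G by (rule assms(1))
  interpret adj: girth5_adj "\<lambda>u v. u \<rightarrow>\<^bsub>G\<^esub> v"
    using dominates_sym dominates_irrefl girth_no_triangle[OF assms(2)]
      girth_no_square[OF assms(2)]
    by unfold_locales
  let ?V = "verts G"
  have vdec: "adj.vdec ?V"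
    using assms(3) vertex_decomposable_induce[of ?V] by (simp add: induce_verts)
  have fin: "finite ?V" by simp
  have "delete_verts G {x} = G \<restriction> (?V - {x})" for x
    using delete_verts_induce[of ?V "{x}"] by (simp only: induce_verts)
  moreover have "delete_verts G (closed_nbhd G x) = G \<restriction> adj.link ?V x" if "x \<in> ?V" for x
    using delete_closed_nbhd_induce[OF that] by (simp only: induce_verts)
  \<comment> \<open>\<open>vdec_link\<close> makes the link condition automatic, leaving only the
    deletion.\<close>
  ultimately have Shed: "Shed G = {x \<in> ?V. adj.vdec (?V - {x})}"
    using adj.vdec_link[OF vdec fin] by (auto simp: Shed_def vertex_decomposable_induce)
  show ?thesis
    unfolding dominating_set_def
  proof (intro conjI ballI)
    show "Shed G \<subseteq> ?V" by (auto simp: Shed)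
    fix v assume v: "v \<in> ?V - Shed G"
    then obtain d where "d \<in> ?V" "adj.vdec (?V - {d})" "d = v \<or> v \<rightarrow>\<^bsub>G\<^esub> d"
      using adj.good_imp_shed_nearby[OF fin vdec] adj.vdec_good[OF fin vdec] by blast
    then show "\<exists>d\<in>Shed G. v \<rightarrow>\<^bsub>G\<^esub> d" using v by (auto simp: Shed)
  qed
qed

end
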